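(* Let $\tau$ be an operator mean and let $\alpha:=f_\tau'(1)\in[0,1]$. Let $s_k\in(0,1]$ and $r_k\in[-1,1]$, $k\in\mathbb N$, be such that $s_k\to0$ and $r_k\to r$. Then $\tau_{s_k,r_k}\to\mathfrak p_{\alpha,r}$ properly. Thus, letting $\tau_{0,r}:=\mathfrak p_{\alpha,r}$ for $r\in[-1,1]$, the operator means $\tau_{s,r}$ with two parameters $s\in[0,1]$ and $r\in[-1,1]$ form a continuous family, i.e., if $(s_k,r_k)\to(s,r)$ in $[0,1]\times[-1,1]$ then $\tau_{s_k,r_k}\to\tau_{s,r}$ properly.
   Context: Operator means are in the sense of Kubo–Ando, on the positive operators of an infinite-dimensional separable Hilbert space $\mathcal H$. Each operator mean $\sigma$ corresponds bijectively to its representing function $f_\sigma$, a non-negative operator monotone function on $[0,\infty)$ with $f_\sigma(1)=1$, through $A\sigma B=A^{1/2}f_\sigma(A^{-1/2}BA^{-1/2})A^{1/2}$ for positive invertible $A,B$ (extended to positive $A,B$ by $A\sigma B=\lim_{\varepsilon\searrow0}(A+\varepsilon I)\sigma(B+\varepsilon I)$). $\mathfrak l$ is the left trivial mean $A\mathfrak lB=A$. Deformed operator mean: for operator means $\tau,\sigma$ with $\sigma\ne\mathfrak l$, $\tau_\sigma$ is the operator mean such that for positive invertible $A,B$, $X=A\tau_\sigma B$ is the unique positive invertible solution of $X=(X\sigma A)\tau(X\sigma B)$; equivalently, for each $t>0$, $x=f_{\tau_\sigma}(t)$ is the unique $x>0$ with $f_\sigma(1/x)f_\tau\bigl(f_\sigma(t/x)/f_\sigma(1/x)\bigr)=1$.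 Weighted power means: for $s\in[0,1]$ and $r\in[-1,1]$, $\mathfrak p_{s,r}$ is the operator mean with representing function $f_{s,r}(t)=(1-s+st^r)^{1/r}$ if $r\ne0$, and $f_{s,0}(t)=t^s$ if $r=0$. For $s\in(0,1]$, $r\in[-1,1]$: $\tau_{s,r}:=\tau_{\mathfrak p_{s,r}}$. Proper convergence $\tau_k\to\tau$ of operator means means $f_{\tau_k}(t)\to f_\tau(t)$ for every $t\in(0,\infty)$ (equivalently, uniformly on $[\delta,\delta^{-1}]$ for every $\delta\in(0,1)$; equivalently, $A\tau_kB\to A\tau B$ in operator norm for all positive invertible $A,B$). *)

theory Defs
  imports "HOL-Analysis.Analysis"
begin

text \<open>Complex Hilbert spaces. The inner product is conjugate-linear in the first argument; its
  positive definiteness and the norm are inherited from the underlying real inner product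
  \<^term>\<open>x \<bullet> y\<close>, which is its real part.\<close>

class complex_inner = real_inner +
  fixes scaleC :: "complex \<Rightarrow> 'a \<Rightarrow> 'a" (infixr \<open>*\<^sub>C\<close> 75)
    and cinner :: "'a \<Rightarrow> 'a \<Rightarrow> complex"
  assumes scaleC_add_right: "c *\<^sub>C (x + y) = c *\<^sub>C x + c *\<^sub>C y"
    and scaleC_add_left: "(c + d) *\<^sub>C x = c *\<^sub>C x + d *\<^sub>C x"
    and scaleC_scaleC: "c *\<^sub>C (d *\<^sub>C x) = (c * d) *\<^sub>C x"
    and scaleR_scaleC: "r *\<^sub>R x = complex_of_real r *\<^sub>C x"
    and cinner_commute: "cinner x y = cnj (cinner y x)"
    and cinner_add_right: "cinner x (y + z) = cinner x y + cinner x z"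
    and cinner_scaleC_right: "cinner x (c *\<^sub>C y) = c * cinner x y"
    and inner_eq_Re_cinner: "x \<bullet> y = Re (cinner x y)"

class complex_hilbert = complex_inner + complete_space

text \<open>Library bounded operators are only real-linear, so complex linearity is part of positivity.\<close>

definition positive_op :: "('a::complex_hilbert \<Rightarrow>\<^sub>L 'a) \<Rightarrow> bool" where
  "positive_op A \<longleftrightarrow>
     (\<forall>c x. blinfun_apply A (c *\<^sub>C x) = c *\<^sub>C blinfun_apply A x) \<and>
     (\<forall>x. cinner x (blinfun_apply A x) \<in> \<real>\<^sub>\<ge>\<^sub>0)"

definition op_le :: "('a::complex_hilbert \<Rightarrow>\<^sub>L 'a) \<Rightarrow> ('a \<Rightarrow>\<^sub>L 'a) \<Rightarrow> bool" (infix \<open>\<preceq>\<close> 50) where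
  "A \<preceq> B \<longleftrightarrow> positive_op (B - A)"

definition positive_invertible_op :: "('a::complex_hilbert \<Rightarrow>\<^sub>L 'a) \<Rightarrow> bool" where
  "positive_invertible_op A \<longleftrightarrow>
     positive_op A \<and> (\<exists>B. A o\<^sub>L B = id_blinfun \<and> B o\<^sub>L A = id_blinfun)"

text \<open>Monotone decreasing convergence in the strong operator topology.\<close>

definition op_decreases_to ::
    "(nat \<Rightarrow> ('a::complex_hilbert \<Rightarrow>\<^sub>L 'a)) \<Rightarrow> ('a \<Rightarrow>\<^sub>L 'a) \<Rightarrow> bool" where
  "op_decreases_to X A \<longleftrightarrow>
     (\<forall>n. X (Suc n) \<preceq> X n) \<and>
     (\<forall>x. (\<lambda>n. blinfun_apply (X n) x) \<longlonglongrightarrow> blinfun_apply A x)"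

text \<open>A binary operation on the positive operators is modelled by a total function whose values
  outside the positive operators are irrelevant.\<close>

type_synonym 'a op_binary = "('a \<Rightarrow>\<^sub>L 'a) \<Rightarrow> ('a \<Rightarrow>\<^sub>L 'a) \<Rightarrow> ('a \<Rightarrow>\<^sub>L 'a)"

text \<open>The Kubo--Ando axioms: joint monotonicity, transformer inequality, upper continuity and
  normalization.\<close>

definition operator_mean :: "'a::complex_hilbert op_binary \<Rightarrow> bool" where
  "operator_mean \<sigma> \<longleftrightarrow>
     (\<forall>A B. positive_op A \<longrightarrow> positive_op B \<longrightarrow> positive_op (\<sigma> A B)) \<and>
     (\<forall>A B C D. positive_op A \<longrightarrow> positive_op B \<longrightarrow> A \<preceq> C \<longrightarrow> B \<preceq> D \<longrightarrow> \<sigma> A B \<preceq> \<sigma> C D) \<and>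
     (\<forall>A B C. positive_op A \<longrightarrow> positive_op B \<longrightarrow> positive_op C \<longrightarrow>
        C o\<^sub>L \<sigma> A B o\<^sub>L C \<preceq> \<sigma> (C o\<^sub>L A o\<^sub>L C) (C o\<^sub>L B o\<^sub>L C)) \<and>
     (\<forall>X Y A B. (\<forall>n. positive_op (X n)) \<longrightarrow> (\<forall>n. positive_op (Y n)) \<longrightarrow>
        op_decreases_to X A \<longrightarrow> op_decreases_to Y B \<longrightarrow>
        op_decreases_to (\<lambda>n. \<sigma> (X n) (Y n)) (\<sigma> A B)) \<and>
     \<sigma> id_blinfun id_blinfun = id_blinfun"

text \<open>The representing function is determined by $I \mathbin{\sigma} (tI) = f(t) I$ for
  $t \ge 0$; its values at negative arguments carry no meaning.\<close>

definition rep_fun :: "'a::complex_hilbert op_binary \<Rightarrow> real \<Rightarrow> real" where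
  "rep_fun \<sigma> t = (THE y. \<sigma> id_blinfun (t *\<^sub>R id_blinfun) = y *\<^sub>R id_blinfun)"

definition power_mean_fun :: "real \<Rightarrow> real \<Rightarrow> real \<Rightarrow> real" where
  "power_mean_fun s r t =
     (if r = 0 then t powr s else (1 - s + s * t powr r) powr (1 / r))"

text \<open>Only \<^term>\<open>t > 0\<close> is required: an operator mean is determined by its representing function on
  the open half-line, the value at 0 being the limit there, and \<^term>\<open>0 powr r = 0\<close> would give the
  wrong value at 0 for negative \<^term>\<open>r\<close>.\<close>

definition is_power_mean :: "real \<Rightarrow> real \<Rightarrow> 'a::complex_hilbert op_binary \<Rightarrow> bool" where
  "is_power_mean s r \<sigma> \<longleftrightarrow> operator_mean \<sigma> \<and> (\<forall>t>0. rep_fun \<sigma> t = power_mean_fun s r t)"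

text \<open>\<open>is_deformed_mean \<tau> \<sigma> \<rho>\<close> says that \<open>\<rho>\<close> is $\tau_\sigma$. It cannot hold when \<open>\<sigma>\<close> is the left
  trivial mean (on a nonzero space), since then every \<open>X\<close> solves the equation.\<close>

definition is_deformed_mean ::
    "'a::complex_hilbert op_binary \<Rightarrow> 'a op_binary \<Rightarrow> 'a op_binary \<Rightarrow> bool" where
  "is_deformed_mean \<tau> \<sigma> \<rho> \<longleftrightarrow>
     operator_mean \<rho> \<and>
     (\<forall>A B. positive_invertible_op A \<longrightarrow> positive_invertible_op B \<longrightarrow>
        (\<forall>X. positive_invertible_op X \<and> X = \<tau> (\<sigma> X A) (\<sigma> X B) \<longleftrightarrow> X = \<rho> A B))"

definition converges_properly ::
    "(nat \<Rightarrow> 'a::complex_hilbert op_binary) \<Rightarrow> 'a op_binary \<Rightarrow> bool" where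
  "converges_properly \<tau>s \<tau> \<longleftrightarrow> (\<forall>t>0. (\<lambda>k. rep_fun (\<tau>s k) t) \<longlonglongrightarrow> rep_fun \<tau> t)"

text \<open>The family $\tau_{s,r}$ extended to $s = 0$, given \<open>T s r\<close> for $s > 0$ and the weighted power
  means \<open>P\<close>.\<close>

definition extended_family ::
    "(real \<Rightarrow> real \<Rightarrow> 'a::complex_hilbert op_binary) \<Rightarrow> (real \<Rightarrow> real \<Rightarrow> 'a op_binary) \<Rightarrow> real
      \<Rightarrow> real \<Rightarrow> real \<Rightarrow> 'a op_binary" where
  "extended_family P T \<alpha> s r = (if s = 0 then P \<alpha> r else T s r)"

end

theory Submission
  imports Defs
begin

text \<open>Compressing by rank-one projections shows that \<open>\<sigma>\<close> acts on scalar operators, and on operators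
  with two eigenvalues, through its representing function \<open>f\<close>, and that \<open>f\<close> is concave. A kink of
  \<open>f\<close> at 1 would contradict operator monotonicity on a two-dimensional subspace, so \<open>f\<close> is
  differentiable there. On scalars, the deformed mean solves
  \<open>f\<^sub>\<sigma>(1/x) f\<^sub>\<tau>(f\<^sub>\<sigma>(t/x) / f\<^sub>\<sigma>(1/x)) = 1\<close>. For the power mean with parameters \<open>s, r\<close> the logarithm of
  this equation, divided by \<open>s\<close>, extends continuously to \<open>s = 0\<close>, where it becomes
  \<open>x\<^sup>r = 1 - \<alpha> + \<alpha> t\<^sup>r\<close>. Every solution lies between \<open>min 1 t\<close> and \<open>max 1 t\<close> and is unique, so by
  compactness it depends continuously on \<open>(s, r)\<close>.\<close>

section \<open>Complex inner products and rank-one perturbations of the identity\<close>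

lemma scaleC_one [simp]: "1 *\<^sub>C x = (x::'a::complex_inner)"
  by (metis scaleR_scaleC of_real_1 scaleR_one)

lemma scaleC_zero_left [simp]: "0 *\<^sub>C x = (0::'a::complex_inner)"
  by (metis scaleR_scaleC of_real_0 scaleR_zero_left)

lemma scaleC_diff_right: "c *\<^sub>C (x - y) = c *\<^sub>C x - c *\<^sub>C (y::'a::complex_inner)"
  by (metis scaleC_add_right add_diff_cancel diff_add_cancel)

lemma cinner_add_left:
  fixes x y z :: "'a::complex_inner"
  shows "cinner (x + y) z = cinner x z + cinner y z"
  by (metis cinner_commute cinner_add_right complex_cnj_add)

lemma cinner_scaleC_left:
  fixes x y :: "'a::complex_inner"
  shows "cinner (c *\<^sub>C x) y = cnj c * cinner x y"
  by (metis cinner_commute cinner_scaleC_right complex_cnj_mult)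

lemma cinner_scaleR_right:
  fixes x y :: "'a::complex_inner"
  shows "cinner x (a *\<^sub>R y) = of_real a * cinner x y"
  by (simp add: scaleR_scaleC cinner_scaleC_right)

lemma cinner_zero_right [simp]: "cinner (x::'a::complex_inner) 0 = 0"
  by (metis cinner_scaleR_right mult_zero_left of_real_0 scaleR_zero_left)

lemma cinner_minus_right:
  fixes x y :: "'a::complex_inner"
  shows "cinner x (- y) = - cinner x y"
  using cinner_scaleR_right[of x "-1" y] by simp

lemma cinner_diff_right:
  fixes x y z :: "'a::complex_inner"
  shows "cinner x (y - z) = cinner x y - cinner x z"
  using cinner_add_right[of x y "- z"] by (simp add: cinner_minus_right)

lemma cinner_self: "cinner x x = of_real ((norm (x::'a::complex_inner))\<^sup>2)"
proof (rule complex_eqI)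
  show "Re (cinner x x) = Re (of_real ((norm x)\<^sup>2))"
    by (simp add: inner_eq_Re_cinner[symmetric] power2_norm_eq_inner)
  have "Im (cinner x x) = - Im (cinner x x)"
    by (metis cinner_commute complex_cnj cnj.sel(2))
  then show "Im (cinner x x) = Im (of_real ((norm x)\<^sup>2))"
    by simp
qed

lemma norm_scaleC: "norm (c *\<^sub>C x) = cmod c * norm (x::'a::complex_inner)"
proof -
  have "of_real ((norm (c *\<^sub>C x))\<^sup>2) = c * cnj c * (of_real ((norm x)\<^sup>2) :: complex)"
    by (simp only: cinner_self[symmetric] cinner_scaleC_left cinner_scaleC_right mult_ac)
  also have "\<dots> = of_real ((cmod c * norm x)\<^sup>2)"
    by (simp add: complex_norm_square[symmetric] power_mult_distrib)
  finally have "(norm (c *\<^sub>C x))\<^sup>2 = (cmod c * norm x)\<^sup>2"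
    by (simp only: of_real_eq_iff)
  then show ?thesis
    by (simp add: power2_eq_iff_nonneg)
qed

text \<open>Multiplying \<open>y\<close> by a phase \<open>c\<close> makes the complex inner product
  real and non-negative without changing norms; the real Cauchy-Schwarz inequality then
  suffices.\<close>

lemma cmod_cinner_le: "cmod (cinner x y) \<le> norm x * norm (y::'a::complex_inner)"
proof (cases "cinner x y = 0")
  case False
  define c where "c = cnj (cinner x y) / cmod (cinner x y)"
  have nc: "cmod c = 1"
    using False by (simp add: c_def norm_divide)
  have "c * cinner x y = of_real (cmod (cinner x y))"
    using False by (simp add: c_def complex_norm_square[symmetric] power2_eq_square mult.commute)
  then have "x \<bullet> (c *\<^sub>C y) = cmod (cinner x y)"
    by (simp add: inner_eq_Re_cinner cinner_scaleC_right)
  then show ?thesis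
    using norm_cauchy_schwarz[of x "c *\<^sub>C y"] by (simp add: norm_scaleC nc)
qed simp

text \<open>For a unit vector \<open>e\<close> this is the self-adjoint operator with eigenvalue
  \<open>a\<close> on the complex line of \<open>e\<close> and \<open>b\<close> on its orthogonal
  complement. Scalar operators are the case \<open>a = b\<close>, and projections have
  \<open>a\<close> and \<open>b\<close> in {0, 1}.\<close>

definition diag_op :: "'a::complex_hilbert \<Rightarrow> real \<Rightarrow> real \<Rightarrow> ('a \<Rightarrow>\<^sub>L 'a)" where
  "diag_op e a b = Blinfun (\<lambda>x. b *\<^sub>R x + (a - b) *\<^sub>R (cinner e x *\<^sub>C e))"

lemma bounded_linear_rank_one:
  "bounded_linear (\<lambda>x. cinner e x *\<^sub>C (e::'a::complex_hilbert))"
proof (rule bounded_linear_intro[where K = "norm e * norm e"])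
  show "cinner e (r *\<^sub>R x) *\<^sub>C e = r *\<^sub>R (cinner e x *\<^sub>C e)" for r x
    by (simp add: cinner_scaleR_right scaleR_scaleC scaleC_scaleC cinner_scaleC_right)
  show "norm (cinner e x *\<^sub>C e) \<le> norm x * (norm e * norm e)" for x
    using mult_right_mono[OF cmod_cinner_le[of e x], of "norm e"]
    by (simp add: norm_scaleC mult_ac)
qed (simp add: cinner_add_right scaleC_add_left)

lemma diag_op_apply:
  "blinfun_apply (diag_op e a b) x = b *\<^sub>R x + (a - b) *\<^sub>R (cinner e x *\<^sub>C e)"
  unfolding diag_op_def
  by (subst bounded_linear_Blinfun_apply)
    (intro bounded_linear_add bounded_linear_scaleR_right bounded_linear_const_scaleR
      bounded_linear_ident bounded_linear_rank_one | simp)+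

lemma diag_op_same: "diag_op e a a = a *\<^sub>R id_blinfun"
  by (rule blinfun_eqI) (simp add: diag_op_apply blinfun.scaleR_left)

lemma diag_op_diff: "diag_op e a b - diag_op e c d = diag_op e (a - c) (b - d)"
  by (rule blinfun_eqI) (simp add: diag_op_apply blinfun.diff_left algebra_simps)

lemma diag_op_scaleR: "c *\<^sub>R diag_op e a b = diag_op e (c * a) (c * b)"
  by (rule blinfun_eqI) (simp add: diag_op_apply blinfun.scaleR_left algebra_simps)

lemma diag_op_compose:
  assumes "norm e = 1"
  shows "diag_op e a b o\<^sub>L diag_op e c d = diag_op e (a * c) (b * d)"
proof (rule blinfun_eqI)
  fix x
  have "cinner e (blinfun_apply (diag_op e c d) x) = of_real c * cinner e x"
    by (simp add: diag_op_apply cinner_add_right cinner_diff_right cinner_scaleC_right cinner_scaleR_right cinner_self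
        assms algebra_simps)
  moreover have "(of_real c * cinner e x) *\<^sub>C e = c *\<^sub>R (cinner e x *\<^sub>C e)"
    by (simp add: scaleR_scaleC scaleC_scaleC)
  ultimately have "blinfun_apply (diag_op e a b) (blinfun_apply (diag_op e c d) x) =
    b *\<^sub>R blinfun_apply (diag_op e c d) x + (a - b) *\<^sub>R (c *\<^sub>R (cinner e x *\<^sub>C e))"
    by (simp add: diag_op_apply[of e a b])
  then show "blinfun_apply (diag_op e a b o\<^sub>L diag_op e c d) x = blinfun_apply (diag_op e (a * c) (b * d)) x"
    by (simp add: diag_op_apply algebra_simps)
qed

lemma diag_op_clinear: "blinfun_apply (diag_op e a b) (c *\<^sub>C x) = c *\<^sub>C blinfun_apply (diag_op e a b) x"
  by (simp add: diag_op_apply cinner_scaleC_right scaleC_add_right scaleR_scaleC scaleC_scaleC mult_ac)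

lemma cinner_diag_op:
  "cinner x (blinfun_apply (diag_op e a b) x)
     = of_real (b * (norm x)\<^sup>2 + (a - b) * (cmod (cinner e x))\<^sup>2)"
proof -
  have "cinner e x * cinner x e = of_real ((cmod (cinner e x))\<^sup>2)"
    by (metis cinner_commute complex_norm_square)
  then show ?thesis
    by (simp add: diag_op_apply cinner_add_right cinner_scaleC_right cinner_scaleR_right cinner_self)
qed

lemma inner_diag_op:
  "x \<bullet> blinfun_apply (diag_op e a b) x = b * (norm x)\<^sup>2 + (a - b) * (cmod (cinner e x))\<^sup>2"
  by (simp add: inner_eq_Re_cinner cinner_diag_op)

lemma diag_op_selfadjoint:
  "cinner y (blinfun_apply (diag_op e a b) x) = cinner (blinfun_apply (diag_op e a b) y) x"
proof -
  have "cinner (blinfun_apply (diag_op e a b) y) x = cnj (cinner x (blinfun_apply (diag_op e a b) y))"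
    by (rule cinner_commute)
  also have "\<dots> = cinner y (blinfun_apply (diag_op e a b) x)"
    by (simp add: diag_op_apply cinner_add_right cinner_scaleR_right cinner_scaleC_right
        cinner_commute[symmetric])
  finally show ?thesis ..
qed

section \<open>Positive operators\<close>

lemma positive_op_cinner:
  assumes "positive_op A"
  shows "cinner x (blinfun_apply A x) = of_real (x \<bullet> blinfun_apply A x)" "0 \<le> x \<bullet> blinfun_apply A x"
proof -
  have "cinner x (blinfun_apply A x) \<in> \<real>\<^sub>\<ge>\<^sub>0"
    using assms by (simp add: positive_op_def)
  then show "cinner x (blinfun_apply A x) = of_real (x \<bullet> blinfun_apply A x)" "0 \<le> x \<bullet> blinfun_apply A x"
    by (simp_all add: inner_eq_Re_cinner complex_nonneg_Reals_iff complex_eq_iff)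
qed

lemma op_le_inner: "A \<preceq> B \<Longrightarrow> x \<bullet> blinfun_apply A x \<le> x \<bullet> blinfun_apply B x"
  using positive_op_cinner(2)[of "B - A" x] by (simp add: op_le_def blinfun.diff_left inner_diff_right)

lemma positive_op_add: "positive_op A \<Longrightarrow> positive_op B \<Longrightarrow> positive_op (A + B)"
  by (auto simp: positive_op_def blinfun.add_left scaleC_add_right cinner_add_right
      complex_nonneg_Reals_iff)

lemma op_le_trans [trans]: "A \<preceq> B \<Longrightarrow> B \<preceq> C \<Longrightarrow> A \<preceq> C"
  using positive_op_add[of "B - A" "C - B"] by (simp add: op_le_def)

lemma op_le_refl: "A \<preceq> A"
  by (simp add: op_le_def positive_op_def cinner_scaleC_right)
    (metis scaleR_scaleC scaleC_scaleC scaleR_zero_left mult_zero_right of_real_0)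

lemma positive_diag_op:
  assumes "norm e = 1" "0 \<le> a" "0 \<le> b"
  shows "positive_op (diag_op e a b)"
proof -
  have "b * (norm x)\<^sup>2 + (a - b) * (cmod (cinner e x))\<^sup>2 \<ge> 0" for x
  proof -
    have "(cmod (cinner e x))\<^sup>2 \<le> (norm x)\<^sup>2"
      using cmod_cinner_le[of e x] assms by (intro power_mono) auto
    then have "b * ((norm x)\<^sup>2 - (cmod (cinner e x))\<^sup>2) + a * (cmod (cinner e x))\<^sup>2 \<ge> 0"
      using assms by simp
    then show ?thesis
      by (simp add: algebra_simps)
  qed
  then show ?thesis
    by (simp add: positive_op_def diag_op_clinear cinner_diag_op complex_nonneg_Reals_iff
        del: of_real_add of_real_mult of_real_diff)
qed

lemma diag_op_mono:
  assumes "norm e = 1" "a \<le> c" "b \<le> d"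
  shows "diag_op e a b \<preceq> diag_op e c d"
  using assms by (simp add: op_le_def diag_op_diff positive_diag_op)

text \<open>The quadratic form of \<open>W\<close> attains its minimum 0 at \<open>x\<close>, so its
  first variation vanishes there in every direction \<open>y\<close>. Since the form is also real,
  this forces \<open>W x\<close> to be orthogonal to every \<open>y\<close>, in particular to
  itself.\<close>

lemma positive_op_kernel:
  assumes W: "positive_op W" and x: "x \<bullet> blinfun_apply W x = 0"
  shows "blinfun_apply W x = 0"
proof -
  let ?W = "blinfun_apply W"
  have WC: "?W (c *\<^sub>C y) = c *\<^sub>C ?W y" for c y
    using W by (simp add: positive_op_def)
  have re: "Re (cinner x (?W y)) + Re (cinner y (?W x)) = 0" for y
  proof -
    define p where "p = x \<bullet> ?W y + y \<bullet> ?W x"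
    define q where "q = y \<bullet> ?W y"
    have ge: "0 \<le> l * p + l\<^sup>2 * q" for l
      using positive_op_cinner(2)[OF W, of "x + l *\<^sub>R y"] x
      by (simp add: p_def q_def blinfun.add_right blinfun.scaleR_right inner_add_left
          inner_add_right algebra_simps power2_eq_square)
    have q0: "q \<ge> 0"
      using positive_op_cinner(2)[OF W] by (simp add: q_def)
    have "p = 0"
    proof (rule ccontr)
      assume "p \<noteq> 0"
      \<comment> \<open>A step against the slope \<open>p\<close> makes the form negative; the
        denominator \<open>q + 1\<close> avoids division by zero when \<open>q = 0\<close>.\<close>
      have "(- p / (q + 1)) * p + (- p / (q + 1))\<^sup>2 * q = - p\<^sup>2 / (q + 1)\<^sup>2"
        using q0 by (simp add: power2_eq_square divide_simps) (simp add: algebra_simps)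
      moreover have "p\<^sup>2 / (q + 1)\<^sup>2 > 0"
        using \<open>p \<noteq> 0\<close> q0 by simp
      ultimately show False
        using ge[of "- p / (q + 1)"] by simp
    qed
    then show ?thesis
      by (simp add: p_def inner_eq_Re_cinner)
  qed
  have im: "Im (cinner x (?W y)) + Im (cinner y (?W x)) = 0" for y
  proof -
    have *: "Im (cinner z (?W z)) = 0" for z
      by (simp add: positive_op_cinner(1)[OF W])
    show ?thesis
      using *[of "x + y"] *[of x] *[of y]
      by (simp add: blinfun.add_right cinner_add_left cinner_add_right)
  qed
  \<comment> \<open>Replacing \<open>y\<close> by \<open>\<i> *\<^sub>C y\<close> turns
    \<open>re\<close> into equality of the two imaginary parts, whose sum vanishes by
    \<open>im\<close>; one more such replacement handles the real part.\<close>
  have im0: "Im (cinner y (?W x)) = 0" for y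
    using re[of "\<i> *\<^sub>C y"] im[of y] by (simp add: WC cinner_scaleC_left cinner_scaleC_right)
  have "Re (cinner y (?W x)) = 0" for y
    using im0[of "\<i> *\<^sub>C y"] by (simp add: cinner_scaleC_left)
  then have "?W x \<bullet> ?W x = 0"
    by (simp add: inner_eq_Re_cinner)
  then show ?thesis
    by simp
qed

lemma op_le_antisym:
  assumes "A \<preceq> B" "B \<preceq> A"
  shows "A = B"
proof (rule blinfun_eqI)
  fix x
  have "x \<bullet> blinfun_apply (B - A) x = 0"
    using op_le_inner[OF assms(1), of x] op_le_inner[OF assms(2), of x]
    by (simp add: blinfun.diff_left inner_diff_right)
  then have "blinfun_apply (B - A) x = 0"
    using assms(1) by (intro positive_op_kernel) (simp_all add: op_le_def)
  then show "blinfun_apply A x = blinfun_apply B x"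
    by (simp add: blinfun.diff_left)
qed

text \<open>One Gram-Schmidt step. Since \<open>span\<close> is the real span, the complex line of
  \<open>e1\<close> is the span of the two vectors \<open>e1\<close> and
  \<open>\<i> *\<^sub>C e1\<close>.\<close>

lemma exists_orthonormal_pair:
  assumes "\<And>B :: 'a::complex_hilbert set. finite B \<Longrightarrow> span B \<noteq> UNIV"
  obtains e1 e2 :: "'a::complex_hilbert" where "norm e1 = 1" "norm e2 = 1" "cinner e1 e2 = 0"
proof -
  obtain v :: 'a where "v \<noteq> 0"
    using assms[of "{}"] by auto
  define e1 where "e1 = v /\<^sub>R norm v"
  have n1: "norm e1 = 1"
    using \<open>v \<noteq> 0\<close> by (simp add: e1_def)
  obtain z where z: "z \<notin> span {e1, \<i> *\<^sub>C e1}"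
    using assms[of "{e1, \<i> *\<^sub>C e1}"] by auto
  define z' where "z' = z - cinner e1 z *\<^sub>C e1"
  have "cinner e1 z *\<^sub>C e1 = Re (cinner e1 z) *\<^sub>R e1 + Im (cinner e1 z) *\<^sub>R (\<i> *\<^sub>C e1)"
    by (subst complex_eq) (simp add: scaleC_add_left scaleR_scaleC scaleC_scaleC mult.commute)
  then have "cinner e1 z *\<^sub>C e1 \<in> span {e1, \<i> *\<^sub>C e1}"
    by (simp add: span_add span_scale span_base)
  then have "z' \<noteq> 0"
    using z by (auto simp: z'_def)
  moreover have "cinner e1 z' = 0"
    by (simp add: z'_def cinner_diff_right cinner_scaleC_right cinner_self n1)
  ultimately show ?thesis
    using that[of e1 "z' /\<^sub>R norm z'"] n1 by (simp add: cinner_scaleR_right)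
qed

section \<open>Scalar multiples of the identity on a nonzero space\<close>

context
  fixes e0 :: "'a::complex_hilbert"
  assumes e0: "norm e0 = 1"
begin

text \<open>The unit vector \<open>e0\<close> excludes the zero space, on which all scalar operators
  coincide. This is what makes the description in \<open>rep_fun\<close> unambiguous.\<close>

lemma scaleR_id_eq_iff: "(a *\<^sub>R id_blinfun :: 'a \<Rightarrow>\<^sub>L 'a) = b *\<^sub>R id_blinfun \<longleftrightarrow> a = b"
proof
  assume "a *\<^sub>R id_blinfun = (b *\<^sub>R id_blinfun :: 'a \<Rightarrow>\<^sub>L 'a)"
  then have "blinfun_apply (a *\<^sub>R id_blinfun) e0 = blinfun_apply (b *\<^sub>R id_blinfun) e0"
    by (simp only:)
  then show "a = b"
    using e0 by (auto simp: blinfun.scaleR_left)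
qed simp

lemma scalar_op_le_iff: "a *\<^sub>R id_blinfun \<preceq> (b *\<^sub>R id_blinfun :: 'a \<Rightarrow>\<^sub>L 'a) \<longleftrightarrow> a \<le> b"
proof
  show "a \<le> b" if "a *\<^sub>R id_blinfun \<preceq> (b *\<^sub>R id_blinfun :: 'a \<Rightarrow>\<^sub>L 'a)"
    using op_le_inner[OF that, of e0] e0 by (simp add: blinfun.scaleR_left power2_norm_eq_inner[symmetric])
  show "a *\<^sub>R id_blinfun \<preceq> (b *\<^sub>R id_blinfun :: 'a \<Rightarrow>\<^sub>L 'a)" if "a \<le> b"
    using diag_op_mono[OF e0 that that] by (simp add: diag_op_same)
qed

lemma positive_scalar_op: "a \<ge> 0 \<Longrightarrow> positive_op (a *\<^sub>R id_blinfun :: 'a \<Rightarrow>\<^sub>L 'a)"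
  using positive_diag_op[OF e0, of a a] by (simp add: diag_op_same)

end

lemma op_le_scaleR:
  assumes "A \<preceq> (B :: 'a::complex_hilbert \<Rightarrow>\<^sub>L 'a)" "c \<ge> 0"
  shows "c *\<^sub>R A \<preceq> c *\<^sub>R B"
proof -
  have "positive_op (B - A)"
    using assms by (simp add: op_le_def)
  then have "positive_op (c *\<^sub>R (B - A))"
    using assms(2) by (auto simp: positive_op_def blinfun.scaleR_left cinner_scaleR_right
        scaleR_scaleC scaleC_scaleC mult.commute cinner_scaleC_right complex_nonneg_Reals_iff)
  then show ?thesis
    by (simp add: op_le_def scaleR_diff_right)
qed

section \<open>Components along an orthonormal pair\<close>

context
  fixes e1 e2 :: "'a::complex_hilbert"
  assumes orth: "norm e1 = 1" "norm e2 = 1" "cinner e1 e2 = 0"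
begin

lemma cinner_orth_combination:
  "cinner e1 (a *\<^sub>R e1 + b *\<^sub>R e2) = of_real a"
  "cinner e2 (a *\<^sub>R e1 + b *\<^sub>R e2) = of_real b"
  using orth cinner_commute[of e2 e1]
  by (simp_all add: cinner_add_right cinner_scaleR_right cinner_self)

lemma norm_orth_combination: "(norm (a *\<^sub>R e1 + b *\<^sub>R e2))\<^sup>2 = a\<^sup>2 + b\<^sup>2"
proof -
  have "e1 \<bullet> e2 = 0" "e2 \<bullet> e1 = 0" "e1 \<bullet> e1 = 1" "e2 \<bullet> e2 = 1"
    using orth by (simp_all add: inner_eq_Re_cinner cinner_commute[of e2 e1] cinner_self)
  then show ?thesis
    unfolding power2_norm_eq_inner by (simp add: inner_add_left inner_add_right power2_eq_square)
qed

text \<open>Projecting away the \<open>e1\<close> component lowers the squared norm by exactly its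
  square and leaves the \<open>e2\<close> component unchanged, to which Cauchy-Schwarz
  applies.\<close>

lemma bessel_pair: "(cmod (cinner e1 x))\<^sup>2 + (cmod (cinner e2 x))\<^sup>2 \<le> (norm x)\<^sup>2"
proof -
  define D where "D = diag_op e1 0 1"
  define z where "z = blinfun_apply D x"
  have "cinner z z = cinner x (blinfun_apply (D o\<^sub>L D) x)"
    by (simp add: z_def D_def diag_op_selfadjoint)
  also have "\<dots> = of_real ((norm x)\<^sup>2 - (cmod (cinner e1 x))\<^sup>2)"
    using orth(1) by (simp add: D_def diag_op_compose cinner_diag_op del: blinfun_apply_blinfun_compose)
  finally have "(norm z)\<^sup>2 = (norm x)\<^sup>2 - (cmod (cinner e1 x))\<^sup>2"
    unfolding cinner_self of_real_eq_iff .
  moreover have "cinner e2 z = cinner e2 x"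
    using orth cinner_commute[of e2 e1]
    by (simp add: z_def D_def diag_op_apply cinner_diff_right cinner_scaleC_right)
  then have "(cmod (cinner e2 x))\<^sup>2 \<le> (norm z)\<^sup>2"
    using cmod_cinner_le[of e2 z] orth by (metis mult_1 norm_ge_zero power_mono)
  ultimately show ?thesis
    by simp
qed

end

section \<open>Representing functions of operator means\<close>

lemma operator_meanD:
  assumes "operator_mean \<sigma>"
  shows operator_mean_positive: "positive_op A \<Longrightarrow> positive_op B \<Longrightarrow> positive_op (\<sigma> A B)"
    and operator_mean_mono:
      "positive_op A \<Longrightarrow> positive_op B \<Longrightarrow> A \<preceq> C \<Longrightarrow> B \<preceq> D \<Longrightarrow> \<sigma> A B \<preceq> \<sigma> C D"
    and operator_mean_transformer:
      "positive_op A \<Longrightarrow> positive_op B \<Longrightarrow> positive_op C \<Longrightarrow>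
        C o\<^sub>L \<sigma> A B o\<^sub>L C \<preceq> \<sigma> (C o\<^sub>L A o\<^sub>L C) (C o\<^sub>L B o\<^sub>L C)"
    and operator_mean_id: "\<sigma> id_blinfun id_blinfun = id_blinfun"
  using assms unfolding operator_mean_def by simp_all

section \<open>Means of scalar operators and of operators with two eigenvalues\<close>

context
  fixes \<sigma> :: "'a::complex_hilbert op_binary" and e0 :: 'a
  assumes mean: "operator_mean \<sigma>" and e0: "norm e0 = 1"
begin

text \<open>With \<open>Q\<close> the projection onto a unit vector \<open>e\<close>, the
  transformer inequality and monotonicity give \<open>Q X Q\<close> below \<open>X\<close>. The two
  quadratic forms agree at \<open>e\<close>, so \<open>e\<close> is in the kernel of the difference
  and hence an eigenvector of \<open>X\<close>. An operator for which every vector is an eigenvector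
  is scalar.\<close>

lemma mean_scalar_exists:
  assumes t: "t \<ge> 0"
  shows "\<exists>y. \<sigma> id_blinfun (t *\<^sub>R id_blinfun) = y *\<^sub>R id_blinfun"
proof -
  define X where "X = \<sigma> id_blinfun (t *\<^sub>R id_blinfun)"
  have unit: "blinfun_apply X e = (e \<bullet> blinfun_apply X e) *\<^sub>R e" if e: "norm e = 1" for e
  proof -
    define Q where "Q = diag_op e 1 0"
    have I: "id_blinfun = diag_op e 1 1" and tI: "t *\<^sub>R id_blinfun = diag_op e t t"
      by (simp_all add: diag_op_same)
    have pos: "positive_op Q" "positive_op (diag_op e t t)" "positive_op (diag_op e 1 1)"
      "positive_op (diag_op e t 0)"
      using e t by (simp_all add: Q_def positive_diag_op)
    have "positive_op X"
      unfolding X_def I tI using pos t by (intro operator_mean_positive[OF mean])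
        (simp_all add: diag_op_scaleR positive_diag_op e)
    then have Xe: "cinner e (blinfun_apply X e) = of_real (e \<bullet> blinfun_apply X e)"
      by (rule positive_op_cinner)
    have "Q o\<^sub>L X o\<^sub>L Q \<preceq> \<sigma> (diag_op e 1 0) (diag_op e t 0)"
      using operator_mean_transformer[OF mean pos(3,2,1)]
      by (simp add: X_def I[symmetric] tI[symmetric])
        (simp add: I tI Q_def diag_op_compose e diag_op_scaleR)
    also have "\<sigma> (diag_op e 1 0) (diag_op e t 0) \<preceq> X"
      unfolding X_def I diag_op_scaleR
      using pos e t by (intro operator_mean_mono[OF mean]) (simp_all add: diag_op_mono positive_diag_op)
    finally have le: "Q o\<^sub>L X o\<^sub>L Q \<preceq> X" .
    have Qe: "blinfun_apply Q e = e"
      by (simp add: Q_def diag_op_apply cinner_self e)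
    have QX: "blinfun_apply (Q o\<^sub>L X o\<^sub>L Q) e = (e \<bullet> blinfun_apply X e) *\<^sub>R e"
      by (simp add: Qe) (simp add: Q_def diag_op_apply Xe, simp add: scaleR_scaleC)
    have "blinfun_apply (X - (Q o\<^sub>L X o\<^sub>L Q)) e = 0"
      using le e by (intro positive_op_kernel)
        (simp_all add: op_le_def blinfun.diff_left QX inner_diff_right power2_norm_eq_inner[symmetric]
          del: blinfun_apply_blinfun_compose)
    then show ?thesis
      using QX by (simp add: blinfun.diff_left del: blinfun_apply_blinfun_compose)
  qed
  have eig: "\<exists>m. blinfun_apply X x = m *\<^sub>R x" for x
  proof (cases "x = 0")
    case False
    define y where "y = x /\<^sub>R norm x"
    have "norm y = 1" and x: "x = norm x *\<^sub>R y"
      using False by (simp_all add: y_def)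
    from unit[OF this(1)] have "blinfun_apply X (norm x *\<^sub>R y) = (y \<bullet> blinfun_apply X y) *\<^sub>R norm x *\<^sub>R y"
      by (metis blinfun.scaleR_right scaleR_left_commute)
    then show ?thesis
      using x by auto
  qed (simp add: blinfun.zero_right)
  obtain l where l: "blinfun_apply X e0 = l *\<^sub>R e0"
    using eig by blast
  \<comment> \<open>The eigenvalues agree because \<open>e0 + x\<close> is an eigenvector too:
    either the comparison forces \<open>l = m\<close>, or \<open>x\<close> is a multiple of
    \<open>e0\<close>.\<close>
  have "blinfun_apply X x = l *\<^sub>R x" for x
  proof -
    obtain m where m: "blinfun_apply X x = m *\<^sub>R x"
      using eig by blast
    obtain n where "blinfun_apply X (e0 + x) = n *\<^sub>R (e0 + x)"
      using eig by blast
    then have *: "(n - l) *\<^sub>R e0 = (m - n) *\<^sub>R x"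
      by (simp add: blinfun.add_right l m algebra_simps)
    show ?thesis
    proof (cases "m = n")
      case True
      then show ?thesis
        using * e0 m by auto
    next
      case False
      have "(1 / (m - n)) *\<^sub>R ((n - l) *\<^sub>R e0) = (1 / (m - n)) *\<^sub>R ((m - n) *\<^sub>R x)"
        by (simp only: *)
      then have "x = ((n - l) / (m - n)) *\<^sub>R e0"
        using False by simp
      then show ?thesis
        by (simp add: blinfun.scaleR_right l)
    qed
  qed
  then have "X = l *\<^sub>R id_blinfun"
    by (intro blinfun_eqI) (simp add: blinfun.scaleR_left)
  then show ?thesis
    unfolding X_def by blast
qed

lemma rep_fun_unique: "\<sigma> id_blinfun (t *\<^sub>R id_blinfun) = y *\<^sub>R id_blinfun \<Longrightarrow> rep_fun \<sigma> t = y"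
  unfolding rep_fun_def by (rule the_equality) (simp, metis scaleR_id_eq_iff[OF e0])

lemma mean_id_scalar: "t \<ge> 0 \<Longrightarrow> \<sigma> id_blinfun (t *\<^sub>R id_blinfun) = rep_fun \<sigma> t *\<^sub>R id_blinfun"
  using mean_scalar_exists rep_fun_unique by metis

lemma mean_id_diag_scalar:
  "t \<ge> 0 \<Longrightarrow> \<sigma> (diag_op e 1 1) (diag_op e t t) = diag_op e (rep_fun \<sigma> t) (rep_fun \<sigma> t)"
  using mean_id_scalar by (simp add: diag_op_same)

text \<open>This is the transformer inequality for the operator \<open>sqrt c\<close> times the
  identity.\<close>

lemma mean_scale_le:
  assumes "positive_op A" "positive_op B" "c \<ge> 0"
  shows "c *\<^sub>R \<sigma> A B \<preceq> \<sigma> (c *\<^sub>R A) (c *\<^sub>R B)"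
proof -
  have *: "(sqrt c *\<^sub>R id_blinfun) o\<^sub>L Z o\<^sub>L (sqrt c *\<^sub>R id_blinfun) = c *\<^sub>R Z" for Z :: "'a \<Rightarrow>\<^sub>L 'a"
    using assms by (intro blinfun_eqI) (simp add: blinfun.scaleR_left blinfun.scaleR_right)
  have "positive_op (sqrt c *\<^sub>R id_blinfun :: 'a \<Rightarrow>\<^sub>L 'a)"
    using assms by (intro positive_scalar_op[OF e0]) simp
  from operator_mean_transformer[OF mean assms(1,2) this] show ?thesis
    by (simp only: *)
qed

text \<open>Homogeneity: \<open>mean_scale_le\<close> with factor \<open>a\<close> gives one
  inequality, and with factor \<open>1 / a\<close> the reverse one.\<close>

lemma mean_scalar_scalar:
  assumes "a > 0" "b \<ge> 0"
  shows "\<sigma> (a *\<^sub>R id_blinfun) (b *\<^sub>R id_blinfun) = (a * rep_fun \<sigma> (b / a)) *\<^sub>R id_blinfun"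
proof (rule op_le_antisym)
  have "a *\<^sub>R \<sigma> (1 *\<^sub>R id_blinfun) ((b / a) *\<^sub>R id_blinfun) \<preceq> \<sigma> (a *\<^sub>R 1 *\<^sub>R id_blinfun) (a *\<^sub>R (b / a) *\<^sub>R id_blinfun)"
    using assms by (intro mean_scale_le positive_scalar_op[OF e0]) auto
  then show "(a * rep_fun \<sigma> (b / a)) *\<^sub>R id_blinfun \<preceq> \<sigma> (a *\<^sub>R id_blinfun) (b *\<^sub>R id_blinfun)"
    using assms by (simp add: mean_id_scalar)
  have "(1 / a) *\<^sub>R \<sigma> (a *\<^sub>R id_blinfun) (b *\<^sub>R id_blinfun)
      \<preceq> \<sigma> ((1 / a) *\<^sub>R a *\<^sub>R id_blinfun) ((1 / a) *\<^sub>R b *\<^sub>R id_blinfun)"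
    using assms by (intro mean_scale_le positive_scalar_op[OF e0]) auto
  then have "(1 / a) *\<^sub>R \<sigma> (a *\<^sub>R id_blinfun) (b *\<^sub>R id_blinfun) \<preceq> rep_fun \<sigma> (b / a) *\<^sub>R id_blinfun"
    using assms by (simp add: mean_id_scalar)
  from op_le_scaleR[OF this, of a]
  show "\<sigma> (a *\<^sub>R id_blinfun) (b *\<^sub>R id_blinfun) \<preceq> (a * rep_fun \<sigma> (b / a)) *\<^sub>R id_blinfun"
    using assms by simp
qed

lemma rep_fun_1: "rep_fun \<sigma> 1 = 1"
  using operator_mean_id[OF mean] by (intro rep_fun_unique) simp

lemma rep_fun_mono: "0 \<le> x \<Longrightarrow> x \<le> y \<Longrightarrow> rep_fun \<sigma> x \<le> rep_fun \<sigma> y"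
  using operator_mean_mono[OF mean, of "1 *\<^sub>R id_blinfun" "x *\<^sub>R id_blinfun" "1 *\<^sub>R id_blinfun" "y *\<^sub>R id_blinfun"]
    positive_scalar_op[OF e0, of 1] positive_scalar_op[OF e0, of x] scalar_op_le_iff[OF e0, of 1 1] scalar_op_le_iff[OF e0, of x y]
  by (simp add: mean_id_scalar scalar_op_le_iff[OF e0])

text \<open>By homogeneity \<open>rep_fun \<sigma> y / y\<close> is the coefficient of the mean of
  \<open>1 / y\<close> and 1, so monotonicity in the first argument applies.\<close>

lemma rep_fun_divide_antimono:
  assumes "0 < x" "x \<le> y"
  shows "rep_fun \<sigma> y / y \<le> rep_fun \<sigma> x / x"
proof -
  have "\<sigma> ((1 / y) *\<^sub>R id_blinfun) (1 *\<^sub>R id_blinfun) \<preceq> \<sigma> ((1 / x) *\<^sub>R id_blinfun) (1 *\<^sub>R id_blinfun)"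
    using assms scalar_op_le_iff[OF e0, of 1 1] scalar_op_le_iff[OF e0, of "1 / y" "1 / x"]
    by (intro operator_mean_mono[OF mean] positive_scalar_op[OF e0]) (simp_all add: frac_le)
  then show ?thesis
    using assms by (simp only: mean_scalar_scalar zero_less_divide_1_iff zero_le_one order_less_le_trans[OF assms])
      (simp add: scalar_op_le_iff[OF e0])
qed

text \<open>Compare the increasing \<open>f t\<close> and the decreasing \<open>f t / t\<close> with
  their common value 1 at \<open>t = 1\<close>. The bounds later confine all solutions of the scalar
  equation to one compact interval.\<close>

lemma rep_fun_bounds:
  assumes "t > 0"
  shows "min 1 t \<le> rep_fun \<sigma> t" "rep_fun \<sigma> t \<le> max 1 t"
  using rep_fun_mono[of t 1] rep_fun_mono[of 1 t] rep_fun_divide_antimono[of t 1]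
    rep_fun_divide_antimono[of 1 t] assms
  by (cases "t \<le> 1"; simp add: rep_fun_1 field_simps)+

lemma rep_fun_pos: "t > 0 \<Longrightarrow> rep_fun \<sigma> t > 0"
  using rep_fun_bounds(1)[of t] by linarith

text \<open>\<open>Q\<close> is a spectral projection, as \<open>c\<close> and \<open>d\<close> are
  0 or 1, and the second operand acts as \<open>b\<close> on its range. The mean \<open>Z\<close> of
  \<open>Q\<close> and \<open>b Q\<close> is squeezed: compressing \<open>X\<close> bounds its form
  on the range of \<open>Q\<close> above by that of \<open>Z\<close>, hence by \<open>f b\<close>,
  while compressing the mean of scalars gives \<open>f b Q\<close> below \<open>Z\<close>, hence
  below \<open>X\<close>. So \<open>X - f b Q\<close> is positive with form zero on the range of
  \<open>Q\<close>, and \<open>positive_op_kernel\<close> applies.\<close>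

lemma mean_compose_eigenprojection:
  assumes e: "norm e = 1" and b: "0 \<le> b1" "0 \<le> b2" "0 \<le> b"
    and cd: "c * c = c" "d * d = d" "0 \<le> c" "0 \<le> d" "c \<le> 1" "d \<le> 1" "c * b1 = c * b" "d * b2 = d * b"
  defines "Q \<equiv> diag_op e c d" and "X \<equiv> \<sigma> (diag_op e 1 1) (diag_op e b1 b2)"
  shows "X o\<^sub>L Q = rep_fun \<sigma> b *\<^sub>R Q"
proof (rule blinfun_eqI)
  fix x
  have Q: "positive_op Q"
    unfolding Q_def using cd e by (intro positive_diag_op)
  have comp: "Q o\<^sub>L diag_op e g h o\<^sub>L Q = diag_op e (c * g) (d * h)" for g h
  proof -
    have "c * g * c = c * g" "d * h * d = d * h"
      using cd(1,2) by (metis mult.assoc mult.commute)+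
    then show ?thesis
      by (simp only: Q_def diag_op_compose e)
  qed
  have QQ: "blinfun_apply Q (blinfun_apply Q x) = blinfun_apply Q x"
    using diag_op_compose[OF e, of c d c d] cd by (simp add: Q_def flip: blinfun_apply_blinfun_compose)
  define y where "y = blinfun_apply Q x"
  have Qy: "blinfun_apply Q y = y"
    by (simp add: y_def QQ)
  define Z where "Z = \<sigma> Q (diag_op e (c * b) (d * b))"
  have pos: "positive_op (diag_op e 1 1)" "positive_op (diag_op e b1 b2)" "positive_op (diag_op e b b)"
      "positive_op (diag_op e (c * b) (d * b))"
    using e b cd by (auto intro!: positive_diag_op)
  have "Q o\<^sub>L X o\<^sub>L Q \<preceq> Z"
    using operator_mean_transformer[OF mean pos(1,2) Q] cd by (simp add: X_def Z_def comp Q_def[symmetric])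
  from op_le_inner[OF this, of y]
  have 1: "y \<bullet> blinfun_apply Q (blinfun_apply X y) \<le> y \<bullet> blinfun_apply Z y"
    by (simp add: Qy)
  have "y \<bullet> blinfun_apply Q z = y \<bullet> z" for z
  proof -
    have "cinner y (blinfun_apply Q z) = cinner (blinfun_apply Q y) z"
      unfolding Q_def by (rule diag_op_selfadjoint)
    then show ?thesis
      by (simp add: Qy inner_eq_Re_cinner)
  qed
  with 1 have 1: "y \<bullet> blinfun_apply X y \<le> y \<bullet> blinfun_apply Z y"
    by simp
  have "Z \<preceq> \<sigma> (diag_op e 1 1) (diag_op e b b)"
    unfolding Z_def using e b cd Q pos
    by (intro operator_mean_mono[OF mean]) (auto simp: Q_def intro!: diag_op_mono mult_left_le_one_le)
  from op_le_inner[OF this, of y] have 2: "y \<bullet> blinfun_apply Z y \<le> rep_fun \<sigma> b * (y \<bullet> y)"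
    using b by (simp add: mean_id_diag_scalar) (simp add: diag_op_same blinfun.scaleR_left)
  have "Q o\<^sub>L \<sigma> (diag_op e 1 1) (diag_op e b b) o\<^sub>L Q \<preceq> Z"
    using operator_mean_transformer[OF mean pos(1,3) Q] by (simp add: Z_def comp Q_def[symmetric])
  \<comment> \<open>Rewriting \<open>c * b\<close> and \<open>d * b\<close> as \<open>c * b1\<close>
    and \<open>d * b2\<close> shows that the second operand of \<open>Z\<close> lies below that of
    \<open>X\<close>.\<close>
  also have "Z \<preceq> X"
    unfolding Z_def X_def using e b cd Q pos
    by (intro operator_mean_mono[OF mean])
      (auto simp: Q_def simp flip: cd(7,8) intro!: diag_op_mono mult_left_le_one_le)
  finally have "rep_fun \<sigma> b *\<^sub>R Q \<preceq> X"
    using b by (simp add: mean_id_diag_scalar comp) (simp add: Q_def diag_op_scaleR mult.commute)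
  then have 3: "positive_op (X - rep_fun \<sigma> b *\<^sub>R Q)"
    by (simp add: op_le_def)
  have "y \<bullet> blinfun_apply (X - rep_fun \<sigma> b *\<^sub>R Q) y = 0"
    using positive_op_cinner(2)[OF 3, of y] 1 2
    by (simp add: blinfun.diff_left blinfun.scaleR_left Qy inner_diff_right)
  from positive_op_kernel[OF 3 this] show "blinfun_apply (X o\<^sub>L Q) x = blinfun_apply (rep_fun \<sigma> b *\<^sub>R Q) x"
    by (simp add: blinfun.diff_left blinfun.scaleR_left Qy y_def QQ)
qed

text \<open>The two spectral projections sum to the identity, and
  \<open>mean_compose_eigenprojection\<close> determines the mean on the range of each.\<close>

lemma mean_diag:
  assumes e: "norm e = 1" and b: "0 \<le> b1" "0 \<le> b2"
  shows "\<sigma> (diag_op e 1 1) (diag_op e b1 b2) = diag_op e (rep_fun \<sigma> b1) (rep_fun \<sigma> b2)"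
proof (rule blinfun_eqI)
  fix x
  let ?X = "\<sigma> (diag_op e 1 1) (diag_op e b1 b2)"
  have X1: "?X o\<^sub>L diag_op e 1 0 = rep_fun \<sigma> b1 *\<^sub>R diag_op e 1 0"
    using b by (intro mean_compose_eigenprojection e) auto
  have X2: "?X o\<^sub>L diag_op e 0 1 = rep_fun \<sigma> b2 *\<^sub>R diag_op e 0 1"
    using b by (intro mean_compose_eigenprojection e) auto
  have "blinfun_apply ?X x = blinfun_apply ?X (blinfun_apply (diag_op e 1 0) x + blinfun_apply (diag_op e 0 1) x)"
    by (simp add: diag_op_apply)
  also have "\<dots> = blinfun_apply (?X o\<^sub>L diag_op e 1 0) x + blinfun_apply (?X o\<^sub>L diag_op e 0 1) x"
    by (simp add: blinfun.add_right)
  also have "\<dots> = blinfun_apply (diag_op e (rep_fun \<sigma> b1) (rep_fun \<sigma> b2)) x"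
    by (simp only: X1 X2) (simp add: blinfun.scaleR_left diag_op_apply algebra_simps)
  finally show "blinfun_apply ?X x = blinfun_apply (diag_op e (rep_fun \<sigma> b1) (rep_fun \<sigma> b2)) x" .
qed

text \<open>Compression to the line of \<open>u\<close> turns the second operand into the scalar
  \<open>c\<close>, its quadratic form at \<open>u\<close>, which averages \<open>b1\<close> and
  \<open>b2\<close> with weight \<open>w\<close>. The transformer inequality, followed by enlarging
  both compressed operands to scalar operators, is evaluated at \<open>u\<close>.\<close>

lemma rep_fun_jensen:
  fixes e u :: 'a
  assumes e: "norm e = 1" and u: "norm u = 1" and b: "0 \<le> b1" "0 \<le> b2"
  defines "w \<equiv> (cmod (cinner e u))\<^sup>2"
  shows "w * rep_fun \<sigma> b1 + (1 - w) * rep_fun \<sigma> b2 \<le> rep_fun \<sigma> (w * b1 + (1 - w) * b2)"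
proof -
  define Q where "Q = diag_op u 1 0"
  define c where "c = w * b1 + (1 - w) * b2"
  let ?B = "diag_op e b1 b2"
  have w: "0 \<le> w" "w \<le> 1"
    using cmod_cinner_le[of e u] e u by (auto simp: w_def power_le_one)
  have c0: "c \<ge> 0"
    using b w by (simp add: c_def)
  have Qu: "blinfun_apply Q u = u"
    by (simp add: Q_def diag_op_apply cinner_self u)
  have Qx: "blinfun_apply Q x = cinner u x *\<^sub>C u" for x
    by (simp add: Q_def diag_op_apply)
  have Buu: "cinner u (blinfun_apply ?B u) = of_real c"
    by (simp add: cinner_diag_op u c_def w_def algebra_simps)
  have QBQ: "Q o\<^sub>L ?B o\<^sub>L Q = diag_op u c 0"
  proof (rule blinfun_eqI)
    fix x
    have "blinfun_apply (Q o\<^sub>L ?B o\<^sub>L Q) x = (cinner u (blinfun_apply ?B (cinner u x *\<^sub>C u))) *\<^sub>C u"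
      by (simp add: Qx)
    also have "\<dots> = blinfun_apply (diag_op u c 0) x"
      by (simp add: diag_op_clinear cinner_scaleC_right Buu)
        (simp add: diag_op_apply scaleR_scaleC scaleC_scaleC mult.commute)
    finally show "blinfun_apply (Q o\<^sub>L ?B o\<^sub>L Q) x = blinfun_apply (diag_op u c 0) x" .
  qed
  have QIQ: "Q o\<^sub>L diag_op e 1 1 o\<^sub>L Q = diag_op u 1 0"
  proof -
    have "Q o\<^sub>L diag_op e 1 1 o\<^sub>L Q = Q o\<^sub>L diag_op u 1 1 o\<^sub>L Q"
      by (simp add: diag_op_same)
    then show ?thesis
      by (simp add: Q_def diag_op_compose u)
  qed
  have "Q o\<^sub>L \<sigma> (diag_op e 1 1) ?B o\<^sub>L Q \<preceq> \<sigma> (Q o\<^sub>L diag_op e 1 1 o\<^sub>L Q) (Q o\<^sub>L ?B o\<^sub>L Q)"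
    using e u b by (intro operator_mean_transformer[OF mean]) (auto simp: Q_def intro!: positive_diag_op)
  also have "\<dots> = \<sigma> (diag_op u 1 0) (diag_op u c 0)"
    by (simp only: QBQ QIQ)
  also have "\<dots> \<preceq> \<sigma> (diag_op u 1 1) (diag_op u c c)"
    using u c0 by (intro operator_mean_mono[OF mean]) (auto intro!: positive_diag_op diag_op_mono)
  also have "\<dots> = diag_op u (rep_fun \<sigma> c) (rep_fun \<sigma> c)"
    using c0 by (rule mean_id_diag_scalar)
  finally have "Q o\<^sub>L diag_op e (rep_fun \<sigma> b1) (rep_fun \<sigma> b2) o\<^sub>L Q \<preceq> diag_op u (rep_fun \<sigma> c) (rep_fun \<sigma> c)"
    using e b by (simp add: mean_diag)
  from op_le_inner[OF this, of u]
  have "u \<bullet> blinfun_apply Q (blinfun_apply (diag_op e (rep_fun \<sigma> b1) (rep_fun \<sigma> b2)) u) \<le> rep_fun \<sigma> c"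
    by (simp add: Qu inner_diag_op u)
  then show ?thesis
    by (simp add: Qx inner_eq_Re_cinner cinner_scaleC_right cinner_diag_op u cinner_self w_def[symmetric] c_def
        algebra_simps)
qed

end

section \<open>Concavity and differentiability of the representing function\<close>

context
  fixes \<sigma> :: "'a::complex_hilbert op_binary" and e1 e2 :: 'a
  assumes mean: "operator_mean \<sigma>"
    and orth: "norm e1 = 1" "norm e2 = 1" "cinner e1 e2 = 0"
begin

text \<open>In the plane of \<open>e1\<close> and \<open>e2\<close> every weight \<open>w\<close> is
  the squared \<open>e1\<close> component of some unit vector, so \<open>rep_fun_jensen\<close>
  yields all convex combinations.\<close>

lemma rep_fun_concave:
  assumes "0 \<le> w" "w \<le> 1" "0 \<le> x" "0 \<le> y"
  shows "w * rep_fun \<sigma> x + (1 - w) * rep_fun \<sigma> y \<le> rep_fun \<sigma> (w * x + (1 - w) * y)"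
proof -
  define u where "u = sqrt w *\<^sub>R e1 + sqrt (1 - w) *\<^sub>R e2"
  have "(norm u)\<^sup>2 = 1"
    unfolding u_def norm_orth_combination[OF orth] using assms by simp
  then have "norm u = 1"
    by (simp add: power2_eq_1_iff) (metis abs_norm_cancel abs_neg_one norm_ge_zero not_one_le_zero le_minus_one_simps(3))
  moreover have "(cmod (cinner e1 u))\<^sup>2 = w"
    unfolding u_def cinner_orth_combination[OF orth] using assms by simp
  ultimately show ?thesis
    using rep_fun_jensen[OF mean orth(1) orth(1), of u x y] assms by simp
qed

lemma continuous_on_rep_fun: "continuous_on {0<..} (rep_fun \<sigma>)"
proof -
  have "convex_on {0<..} (\<lambda>x. - rep_fun \<sigma> x)"
  proof (rule convex_onI)
    show "- rep_fun \<sigma> ((1 - t) *\<^sub>R x + t *\<^sub>R y) \<le> (1 - t) * - rep_fun \<sigma> x + t * - rep_fun \<sigma> y"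
      if "0 < t" "t < 1" "x \<in> {0<..}" "y \<in> {0<..}" for t x y :: real
      using rep_fun_concave[of "1 - t" x y] that by (simp add: algebra_simps)
  qed auto
  from convex_on_continuous[OF _ this] have "continuous_on {0<..} (\<lambda>x. - rep_fun \<sigma> x)"
    by simp
  from continuous_on_minus[OF this] show ?thesis
    by simp
qed

text \<open>On the span of \<open>e1\<close> and \<open>e2\<close> the difference of the two sides is a positive multiple of the
  rank-one form \<open>|x1 + x2|\<^sup>2\<close>.\<close>

lemma rotated_diag_le:
  assumes T: "0 < T" "T < 1" and eps: "0 < \<epsilon>"
  defines "p \<equiv> (1 + T) / (1 - T)" and "q \<equiv> (1 - T) / (1 + T)"
    and "w \<equiv> (1 / sqrt (1 + T\<^sup>2)) *\<^sub>R e1 + (- T / sqrt (1 + T\<^sup>2)) *\<^sub>R e2"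
  shows "diag_op e1 (1 - \<epsilon>) (1 + \<epsilon>) \<preceq> diag_op w (1 - \<epsilon> * q) (1 + \<epsilon> * p)"
proof -
  have "0 \<le> p * (norm x)\<^sup>2 - (p + q) * (cmod (cinner w x))\<^sup>2 - (norm x)\<^sup>2 + 2 * (cmod (cinner e1 x))\<^sup>2" for x
  proof -
    define X Y where "X = cinner e1 x" and "Y = cinner e2 x"
    have "cinner w x = of_real (1 / sqrt (1 + T\<^sup>2)) * (X - of_real T * Y)"
      by (simp add: w_def cinner_add_left scaleR_scaleC cinner_scaleC_left X_def Y_def diff_divide_distrib)
    then have "(cmod (cinner w x))\<^sup>2 = (1 / sqrt (1 + T\<^sup>2))\<^sup>2 * (cmod (X - of_real T * Y))\<^sup>2"
      by (simp only: norm_mult power_mult_distrib norm_of_real power2_abs)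
    then have wx: "(cmod (cinner w x))\<^sup>2 = (cmod (X - of_real T * Y))\<^sup>2 / (1 + T\<^sup>2)"
      by (simp add: power_divide)
    have nz: "1 - T \<noteq> 0" "1 + T \<noteq> 0" "1 + T\<^sup>2 \<noteq> 0"
      using T by (auto simp: add_nonneg_eq_0_iff)
    have pq: "(p + q) / (1 + T\<^sup>2) = 2 / ((1 - T) * (1 + T))"
      using nz unfolding p_def q_def by (simp add: divide_simps) (simp add: power2_eq_square algebra_simps)
    \<comment> \<open>The vector \<open>x\<close> need not lie in the plane of \<open>e1\<close> and
      \<open>e2\<close>. Since \<open>p - 1\<close> is non-negative, Bessel's inequality reduces the
      claim to the plane.\<close>
    have "p \<ge> 1"
      using T by (simp add: p_def)
    then have "(p - 1) * ((cmod X)\<^sup>2 + (cmod Y)\<^sup>2) \<le> (p - 1) * (norm x)\<^sup>2"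
      unfolding X_def Y_def by (intro mult_left_mono bessel_pair[OF orth]) simp
    moreover have "(p - 1) * ((cmod X)\<^sup>2 + (cmod Y)\<^sup>2) - 2 / ((1 - T) * (1 + T)) * (cmod (X - of_real T * Y))\<^sup>2
        + 2 * (cmod X)\<^sup>2 = 2 * T / ((1 - T) * (1 + T)) * (cmod (X + Y))\<^sup>2"
      using nz unfolding p_def cmod_power2
      by (simp add: divide_simps) (simp add: power2_eq_square algebra_simps)
    moreover have "2 * T / ((1 - T) * (1 + T)) * (cmod (X + Y))\<^sup>2 \<ge> 0"
      using T by simp
    moreover have "(p + q) * (cmod (cinner w x))\<^sup>2 = 2 / ((1 - T) * (1 + T)) * (cmod (X - of_real T * Y))\<^sup>2"
      unfolding pq[symmetric] wx by simp
    ultimately show ?thesis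
      unfolding X_def[symmetric] by (simp add: left_diff_distrib)
  qed
  then have *: "0 \<le> \<epsilon> * (p * (norm x)\<^sup>2 - (p + q) * (cmod (cinner w x))\<^sup>2 - (norm x)\<^sup>2 + 2 * (cmod (cinner e1 x))\<^sup>2)" for x
    using eps by simp
  have "cinner x (blinfun_apply (diag_op w (1 - \<epsilon> * q) (1 + \<epsilon> * p) - diag_op e1 (1 - \<epsilon>) (1 + \<epsilon>)) x)
    = of_real (\<epsilon> * (p * (norm x)\<^sup>2 - (p + q) * (cmod (cinner w x))\<^sup>2 - (norm x)\<^sup>2 + 2 * (cmod (cinner e1 x))\<^sup>2))" for x
    unfolding blinfun.diff_left cinner_diff_right cinner_diag_op
    by (simp only: of_real_diff[symmetric] of_real_eq_iff) (simp add: algebra_simps)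
  then show ?thesis
    using * by (simp add: op_le_def positive_op_def blinfun.diff_left diag_op_clinear
        scaleC_diff_right complex_nonneg_Reals_iff del: of_real_mult of_real_diff of_real_add)
qed

text \<open>Concavity provides a right derivative \<open>b\<close> and a left derivative
  \<open>a\<close> with \<open>b \<le> a\<close>. Linearizing monotonicity of the mean along
  \<open>rotated_diag_le\<close> relates the two, and small rotation parameters \<open>T\<close>
  exclude \<open>b < a\<close>.\<close>

lemma rep_fun_has_derivative_at_1:
  obtains a where "(rep_fun \<sigma> has_real_derivative a) (at 1)" "0 \<le> a" "a \<le> 1"
proof -
  let ?f = "rep_fun \<sigma>"
  define d where "d h = (?f (1 + h) - 1) / h" for h
  define g where "g h = (1 - ?f (1 - h)) / h" for h
  \<comment> \<open>Concavity on the segment from 1 to \<open>1 + k\<close>. Positive and negative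
    \<open>k\<close> give monotonicity of the right quotient \<open>d\<close> and the left quotient
    \<open>g\<close>.\<close>
  have chord: "l * (?f (1 + k) - 1) \<le> ?f (1 + l * k) - 1" if "0 \<le> l" "l \<le> 1" "- 1 \<le> k" for l k
  proof -
    have "l * ?f (1 + k) + (1 - l) * ?f 1 \<le> ?f (l * (1 + k) + (1 - l) * 1)"
      using that by (intro rep_fun_concave) auto
    moreover have "l * (1 + k) + (1 - l) * 1 = 1 + l * k"
      by (simp add: algebra_simps)
    ultimately show ?thesis
      by (simp add: rep_fun_1[OF mean orth(1)] algebra_simps)
  qed
  have d_mono: "- d h \<le> - d k" if "0 < h" "h \<le> k" for h k
    using chord[of "h / k" k] that by (simp add: d_def field_simps)
  have g_mono: "g h \<le> g k" if "0 < h" "h \<le> k" "k < 1" for h k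
    using chord[of "h / k" "- k"] that by (simp add: g_def field_simps)
  have d_le: "d h \<le> 1" if "0 < h" for h
    using rep_fun_bounds(2)[OF mean orth(1), of "1 + h"] that by (simp add: d_def)
  have g_ge: "0 \<le> g h" if "0 < h" "h < 1" for h
    using rep_fun_bounds(2)[OF mean orth(1), of "1 - h"] that by (simp add: g_def)
  have d_le_g: "d h \<le> g h" if "0 < h" "h < 1" for h
  proof -
    have "1 / 2 * ?f (1 + h) + (1 - 1 / 2) * ?f (1 - h) \<le> ?f (1 / 2 * (1 + h) + (1 - 1 / 2) * (1 - h))"
      using that by (intro rep_fun_concave) auto
    then have "?f (1 + h) + ?f (1 - h) \<le> 2"
      by (simp add: rep_fun_1[OF mean orth(1)] field_simps)
    then show ?thesis
      using that unfolding d_def g_def by (intro divide_right_mono) auto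
  qed
  obtain b where b: "(d \<longlongrightarrow> b) (at_right 0)"
  proof -
    have "((\<lambda>h. - d h) \<longlongrightarrow> Inf ((\<lambda>h. - d h) ` ({0<..} \<inter> UNIV))) (at 0 within ({0<..} \<inter> UNIV))"
      using d_le by (intro Lim_right_bound[where K = "-1"] d_mono) auto
    then have "((\<lambda>h. - (- d h)) \<longlongrightarrow> - Inf ((\<lambda>h. - d h) ` ({0<..} \<inter> UNIV))) (at_right 0)"
      by (intro tendsto_minus) simp
    then show ?thesis
      using that by simp
  qed
  obtain a where a: "(g \<longlongrightarrow> a) (at_right 0)"
  proof -
    have "(g \<longlongrightarrow> Inf (g ` ({0<..} \<inter> {..<1}))) (at 0 within ({0<..} \<inter> {..<1}))"
      using g_ge by (intro Lim_right_bound[where K = 0] g_mono) auto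
    moreover have "at 0 within ({0<..} \<inter> {..<1}) = at_right (0::real)"
      by (rule at_within_nhd[of _ "{..<1}"]) auto
    ultimately show ?thesis
      using that by simp
  qed
  have ev: "eventually (\<lambda>h::real. 0 < h \<and> h < 1) (at_right 0)"
    using eventually_at_right[of 0 "1::real"] by (auto intro!: exI[of _ 1])
  have "b \<le> a"
    using ev by (intro tendsto_le[OF _ a b]) (auto elim!: eventually_mono intro: d_le_g)
  have "b \<le> 1"
    using ev by (intro tendsto_upperbound[OF b]) (auto elim!: eventually_mono intro: d_le)
  have "0 \<le> a"
    using ev by (intro tendsto_lowerbound[OF a]) (auto elim!: eventually_mono intro: g_ge)
  have "0 \<le> b"
  proof -
    have "0 \<le> d h" if "0 < h" for h
      using rep_fun_bounds(1)[OF mean orth(1), of "1 + h"] that by (simp add: d_def)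
    then show ?thesis
      using ev by (intro tendsto_lowerbound[OF b]) (auto elim!: eventually_mono)
  qed
  \<comment> \<open>This is the limit of monotonicity of the mean as the perturbation size
    \<open>\<epsilon>\<close> tends to 0, tested on
    \<open>u1 *\<^sub>R e1 + u2 *\<^sub>R e2\<close>. Denominators are cleared so that both sides
    are polynomials in \<open>T\<close> and can be compared at \<open>T = 0\<close>.\<close>
  have key: "(1 - T\<^sup>2) * (1 + T\<^sup>2) * (b * (u1\<^sup>2 + u2\<^sup>2) - (a + b) * u1\<^sup>2)
      \<le> (1 + T)\<^sup>2 * (1 + T\<^sup>2) * b * (u1\<^sup>2 + u2\<^sup>2) - ((1 - T)\<^sup>2 * a + (1 + T)\<^sup>2 * b) * (u1 - T * u2)\<^sup>2"
    if T: "0 < T" "T < 1" for T u1 u2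
  proof -
    define p where "p = (1 + T) / (1 - T)"
    define q where "q = (1 - T) / (1 + T)"
    define w where "w = (1 / sqrt (1 + T\<^sup>2)) *\<^sub>R e1 + (- T / sqrt (1 + T\<^sup>2)) *\<^sub>R e2"
    define u where "u = u1 *\<^sub>R e1 + u2 *\<^sub>R e2"
    define n where "n = u1\<^sup>2 + u2\<^sup>2"
    define v where "v = (u1 - T * u2)\<^sup>2 / (1 + T\<^sup>2)"
    have pq: "0 < p" "0 < q" "q < 1"
      using T by (simp_all add: p_def q_def)
    have T2: "1 + T\<^sup>2 > 0"
      by (simp add: add_pos_nonneg)
    have "(norm w)\<^sup>2 = 1"
      unfolding w_def norm_orth_combination[OF orth] using T2 by (simp add: power_divide add_divide_distrib[symmetric])
    then have nw: "norm w = 1"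
      using norm_ge_zero[of w] by (auto simp: power2_eq_1_iff)
    have nu: "(norm u)\<^sup>2 = n"
      by (simp add: u_def n_def norm_orth_combination[OF orth])
    have eu: "(cmod (cinner e1 u))\<^sup>2 = u1\<^sup>2"
      by (simp add: u_def cinner_orth_combination[OF orth])
    have "cinner w u = of_real ((u1 - T * u2) / sqrt (1 + T\<^sup>2))"
      by (simp add: w_def cinner_add_left scaleR_scaleC[of _ e1] scaleR_scaleC[of _ e2] cinner_scaleC_left
          u_def cinner_orth_combination[OF orth, unfolded scaleR_scaleC] diff_divide_distrib)
    then have wu: "(cmod (cinner w u))\<^sup>2 = v"
      using T2 by (simp only: norm_of_real power2_abs) (simp add: v_def power_divide)
    have le: "d \<epsilon> * n - (g \<epsilon> + d \<epsilon>) * u1\<^sup>2 \<le> p * d (\<epsilon> * p) * n - (q * g (\<epsilon> * q) + p * d (\<epsilon> * p)) * v"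
      if eps: "0 < \<epsilon>" "\<epsilon> < 1" for \<epsilon>
    proof -
      have eq1: "\<epsilon> * q < 1"
        using mult_strict_mono[of \<epsilon> 1 q 1] eps pq by simp
      have pos1: "positive_op (diag_op e1 (1 - \<epsilon>) (1 + \<epsilon>))" "positive_op (diag_op e1 1 1)"
        using eps orth(1) by (simp_all add: positive_diag_op)
      have "\<sigma> (diag_op e1 1 1) (diag_op e1 (1 - \<epsilon>) (1 + \<epsilon>))
          \<preceq> \<sigma> (diag_op w 1 1) (diag_op w (1 - \<epsilon> * q) (1 + \<epsilon> * p))"
        using rotated_diag_le[OF T eps(1)] pos1 orth
        by (intro operator_mean_mono[OF mean]) (simp_all add: diag_op_same op_le_refl p_def q_def w_def)
      then have "diag_op e1 (?f (1 - \<epsilon>)) (?f (1 + \<epsilon>)) \<preceq> diag_op w (?f (1 - \<epsilon> * q)) (?f (1 + \<epsilon> * p))"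
        using eps pq eq1 orth nw by (simp add: mean_diag[OF mean orth(1)])
      from op_le_inner[OF this, of u]
      have "?f (1 + \<epsilon>) * n + (?f (1 - \<epsilon>) - ?f (1 + \<epsilon>)) * u1\<^sup>2
          \<le> ?f (1 + \<epsilon> * p) * n + (?f (1 - \<epsilon> * q) - ?f (1 + \<epsilon> * p)) * v"
        by (simp add: inner_diag_op nu eu wu)
      \<comment> \<open>After this substitution the zeroth-order term \<open>n\<close> cancels on
        both sides and the factor \<open>\<epsilon>\<close> can be divided out.\<close>
      moreover have "?f (1 + \<epsilon>) = 1 + \<epsilon> * d \<epsilon>" "?f (1 - \<epsilon>) = 1 - \<epsilon> * g \<epsilon>"
        "?f (1 + \<epsilon> * p) = 1 + \<epsilon> * (p * d (\<epsilon> * p))" "?f (1 - \<epsilon> * q) = 1 - \<epsilon> * (q * g (\<epsilon> * q))"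
        using eps pq by (simp_all add: d_def g_def)
      ultimately have "\<epsilon> * (d \<epsilon> * n - (g \<epsilon> + d \<epsilon>) * u1\<^sup>2)
          \<le> \<epsilon> * (p * d (\<epsilon> * p) * n - (q * g (\<epsilon> * q) + p * d (\<epsilon> * p)) * v)"
        by (simp add: algebra_simps)
      then show ?thesis
        using eps by simp
    qed
    have scaled: "filterlim (\<lambda>\<epsilon>. \<epsilon> * c) (at_right 0) (at_right 0)" if "0 < c" for c :: real
    proof -
      have "((\<lambda>\<epsilon>. \<epsilon> * c) \<longlongrightarrow> 0 * c) (at_right 0)"
        by (intro tendsto_intros)
      then show ?thesis
        using that unfolding filterlim_at by (auto simp: eventually_at_filter)
    qed
    have dp: "((\<lambda>\<epsilon>. d (\<epsilon> * p)) \<longlongrightarrow> b) (at_right 0)" and gq: "((\<lambda>\<epsilon>. g (\<epsilon> * q)) \<longlongrightarrow> a) (at_right 0)"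
      using filterlim_compose[OF b scaled] filterlim_compose[OF a scaled] pq by blast+
    have "b * n - (a + b) * u1\<^sup>2 \<le> p * b * n - (q * a + p * b) * v"
    proof (rule tendsto_le)
      show "((\<lambda>\<epsilon>. d \<epsilon> * n - (g \<epsilon> + d \<epsilon>) * u1\<^sup>2) \<longlongrightarrow> b * n - (a + b) * u1\<^sup>2) (at_right 0)"
        by (intro tendsto_intros a b)
      show "((\<lambda>\<epsilon>. p * d (\<epsilon> * p) * n - (q * g (\<epsilon> * q) + p * d (\<epsilon> * p)) * v)
          \<longlongrightarrow> p * b * n - (q * a + p * b) * v) (at_right 0)"
        by (intro tendsto_intros dp gq)
      show "eventually (\<lambda>\<epsilon>. d \<epsilon> * n - (g \<epsilon> + d \<epsilon>) * u1\<^sup>2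
          \<le> p * d (\<epsilon> * p) * n - (q * g (\<epsilon> * q) + p * d (\<epsilon> * p)) * v) (at_right 0)"
        using ev by (rule eventually_mono) (use le in blast)
    qed simp
    moreover have c: "0 < (1 - T\<^sup>2) * (1 + T\<^sup>2)"
      using T T2 by (simp add: power_less_one_iff abs_square_less_1)
    ultimately have "((1 - T\<^sup>2) * (1 + T\<^sup>2)) * (b * n - (a + b) * u1\<^sup>2)
        \<le> ((1 - T\<^sup>2) * (1 + T\<^sup>2)) * (p * b * n - (q * a + p * b) * v)"
      by (intro mult_left_mono) auto
    also have "\<dots> = ((1 - T\<^sup>2) * p) * (1 + T\<^sup>2) * b * n - (((1 - T\<^sup>2) * q) * a + ((1 - T\<^sup>2) * p) * b) * ((1 + T\<^sup>2) * v)"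
      by (simp add: algebra_simps)
    also have "(1 - T\<^sup>2) * p = (1 + T)\<^sup>2"
      using T by (simp add: p_def divide_simps) (simp add: power2_eq_square algebra_simps)
    also have "(1 - T\<^sup>2) * q = (1 - T)\<^sup>2"
      using T by (simp add: q_def divide_simps) (simp add: power2_eq_square algebra_simps)
    also have "(1 + T\<^sup>2) * v = (u1 - T * u2)\<^sup>2"
      using T2 by (simp add: v_def)
    finally show ?thesis
      by (simp add: n_def)
  qed
  \<comment> \<open>The inequality \<open>key\<close> is an equality at \<open>T = 0\<close>, where its two sides differ by
    \<open>2 (a u1 + b u2) (u1 + u2) T\<close> to first order; this is negative for suitable \<open>u\<close> unless \<open>a = b\<close>.\<close>
  have "a = b"
  proof (rule ccontr)
    assume "a \<noteq> b"
    with \<open>b \<le> a\<close> have ab: "b < a"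
      by simp
    \<comment> \<open>With this choice \<open>a * u1 + b * u2\<close> is \<open>a * (a - b)\<close>
      and \<open>u1 + u2\<close> is \<open>b - a\<close>, so the slope at 0 is negative when
      \<open>0 \<le> b < a\<close>.\<close>
    define u1 u2 where "u1 = a + b" and "u2 = - (2 * a)"
    define F where "F T = ((1 + T)\<^sup>2 * (1 + T\<^sup>2) * b * (u1\<^sup>2 + u2\<^sup>2) - ((1 - T)\<^sup>2 * a + (1 + T)\<^sup>2 * b) * (u1 - T * u2)\<^sup>2)
      - ((1 - T\<^sup>2) * (1 + T\<^sup>2) * (b * (u1\<^sup>2 + u2\<^sup>2) - (a + b) * u1\<^sup>2))" for T
    have "(F has_real_derivative 2 * (a * u1 + b * u2) * (u1 + u2)) (at 0)"
      unfolding F_def[abs_def]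
      by (auto intro!: derivative_eq_intros) (simp add: algebra_simps power2_eq_square)
    moreover have "2 * (a * u1 + b * u2) * (u1 + u2) = - (2 * a * (a - b)\<^sup>2)"
      by (simp add: u1_def u2_def power2_eq_square algebra_simps)
    moreover have "2 * a * (a - b)\<^sup>2 > 0"
      using ab \<open>0 \<le> b\<close> by simp
    ultimately obtain \<delta> where \<delta>: "\<delta> > 0" "\<And>h. 0 < h \<Longrightarrow> h < \<delta> \<Longrightarrow> F (0 + h) < F 0"
      using DERIV_neg_dec_right[of F _ 0] by (metis neg_less_0_iff_less)
    define h where "h = min (\<delta> / 2) (1 / 2)"
    have h: "0 < h" "h < \<delta>" "h < 1"
      using \<delta>(1) by (auto simp: h_def)
    have "F 0 = 0"
      by (simp add: F_def algebra_simps)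
    moreover have "F h \<ge> 0"
      using key[OF h(1,3), of u1 u2] by (simp add: F_def)
    ultimately show False
      using \<delta>(2)[OF h(1,2)] by simp
  qed
  have "((\<lambda>h. (?f (1 + h) - ?f 1) / h) \<longlongrightarrow> a) (at 0)"
    unfolding filterlim_at_split
  proof
    show "((\<lambda>h. (?f (1 + h) - ?f 1) / h) \<longlongrightarrow> a) (at_right 0)"
      using b by (simp add: d_def[abs_def] rep_fun_1[OF mean orth(1)] \<open>a = b\<close>)
    have "(?f (1 + - h) - ?f 1) / - h = g h" for h
      by (simp add: g_def rep_fun_1[OF mean orth(1)] minus_divide_left)
    then show "((\<lambda>h. (?f (1 + h) - ?f 1) / h) \<longlongrightarrow> a) (at_left 0)"
      using a by (simp add: filterlim_at_left_to_right[of _ _ 0])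
  qed
  then have "(?f has_real_derivative a) (at 1)"
    by (simp add: DERIV_def)
  then show ?thesis
    using that \<open>0 \<le> a\<close> \<open>b \<le> 1\<close> \<open>a = b\<close> by blast
qed

end

section \<open>The scalar fixed point equation\<close>

text \<open>When \<open>k 0 = 0\<close> and \<open>l\<close> is the derivative of \<open>k\<close>
  at 0, this is the difference quotient of \<open>k\<close> at 0 with its removable singularity
  filled in.\<close>

definition dquot :: "(real \<Rightarrow> real) \<Rightarrow> real \<Rightarrow> real \<Rightarrow> real" where
  "dquot k l z = (if z = 0 then l else k z / z)"

lemma dquot_mult: "k 0 = 0 \<Longrightarrow> z * dquot k l z = k z"
  by (simp add: dquot_def)

lemma isCont_dquot:
  assumes k: "(k has_real_derivative l) (at 0)" "k 0 = 0"
    and S: "open S" "continuous_on S k" "z \<in> S"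
  shows "isCont (dquot k l) z"
proof (cases "z = 0")
  case True
  have "((\<lambda>h. (k (0 + h) - k 0) / h) \<longlongrightarrow> l) (at 0)"
    using k(1) by (simp only: DERIV_def)
  moreover have "eventually (\<lambda>h. (k (0 + h) - k 0) / h = dquot k l h) (at 0)"
    by (auto simp: eventually_at_filter dquot_def k(2))
  ultimately have "(dquot k l \<longlongrightarrow> l) (at 0)"
    by (rule Lim_transform_eventually)
  then show ?thesis
    using True by (simp add: isCont_def dquot_def)
next
  case False
  have "isCont k z"
    using S by (simp add: continuous_on_eq_continuous_at)
  then have "isCont (\<lambda>z. k z / z) z"
    using False by (intro continuous_intros) auto
  moreover have "eventually (\<lambda>h. dquot k l h = k h / h) (nhds z)"
    by (rule eventually_mono[OF eventually_nhds_in_open[of "- {0}" z]])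
      (use False in \<open>auto simp: dquot_def open_Compl\<close>)
  ultimately show ?thesis
    by (simp add: isCont_cong)
qed

text \<open>For \<open>s > 0\<close> this is the logarithm of the power mean function divided by
  \<open>s\<close>. With \<open>u = r ln y\<close> and \<open>v = s (exp u - 1)\<close> it is
  factored as \<open>ln y\<close> times \<open>(exp u - 1) / u\<close> times
  \<open>ln (1 + v) / v\<close>, so both degenerate cases \<open>r = 0\<close> and
  \<open>s = 0\<close> become removable singularities.\<close>

definition pm_log :: "real \<Rightarrow> real \<Rightarrow> real \<Rightarrow> real" where
  "pm_log s r y = ln y * dquot (\<lambda>z. exp z - 1) 1 (r * ln y)
     * dquot (\<lambda>z. ln (1 + z)) 1 (s * (exp (r * ln y) - 1))"

text \<open>\<open>1 + s * (exp z - 1)\<close> is a convex combination of 1 and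
  \<open>exp z\<close>; this keeps the logarithm in \<open>pm_log\<close> inside its domain.\<close>

lemma pm_log_arg:
  fixes s z :: real
  assumes "0 \<le> s" "s \<le> 1"
  shows "- 1 < s * (exp z - 1)"
proof (cases "s = 0")
  case False
  then have "s * exp z > 0"
    using assms by simp
  then show ?thesis
    using assms by (simp add: right_diff_distrib)
qed simp

lemma power_mean_fun_eq_exp:
  assumes s: "0 \<le> s" "s \<le> 1" and y: "y > 0"
  shows "power_mean_fun s r y = exp (s * pm_log s r y)"
proof (cases "r = 0 \<or> ln y = 0 \<or> s = 0")
  case True
  then show ?thesis
    using y by (auto simp: power_mean_fun_def pm_log_def dquot_def powr_def)
next
  case False
  define c where "c = exp (r * ln y) - 1"
  have "c \<noteq> 0"
    using False by (simp add: c_def)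
  have "s * pm_log s r y = ln (1 + s * c) / r"
    using False \<open>c \<noteq> 0\<close> by (simp add: pm_log_def dquot_def c_def[symmetric])
  moreover have "1 - s + s * y powr r = 1 + s * c"
    using y by (simp add: powr_def c_def algebra_simps)
  moreover have "1 + s * c > 0"
    using pm_log_arg[OF s, of "r * ln y"] by (simp add: c_def)
  ultimately show ?thesis
    using False by (simp add: power_mean_fun_def powr_def)
qed

lemma pm_log_0:
  assumes "y > 0"
  shows "pm_log 0 r y = (if r = 0 then ln y else (y powr r - 1) / r)"
  using assms by (auto simp: pm_log_def dquot_def powr_def)

text \<open>Joint continuity holds through \<open>s0 = 0\<close> and \<open>r0 = 0\<close> because
  \<open>isCont_dquot\<close> covers the filled-in points of both quotients.\<close>

lemma tendsto_pm_log:
  assumes lim: "s \<longlonglongrightarrow> s0" "r \<longlonglongrightarrow> r0" "y \<longlonglongrightarrow> y0"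
    and y0: "y0 > 0" and s0: "0 \<le> s0" "s0 \<le> 1"
  shows "(\<lambda>k. pm_log (s k) (r k) (y k)) \<longlonglongrightarrow> pm_log s0 r0 y0"
proof -
  have E: "isCont (dquot (\<lambda>z. exp z - 1) 1) z" for z
    by (rule isCont_dquot[where S = UNIV])
      (auto intro!: derivative_eq_intros continuous_intros)
  have L: "isCont (dquot (\<lambda>z. ln (1 + z)) 1) z" if "- 1 < z" for z
    by (rule isCont_dquot[where S = "{- 1<..}"])
      (use that in \<open>auto intro!: derivative_eq_intros continuous_intros\<close>)
  have "(\<lambda>k. r k * ln (y k)) \<longlonglongrightarrow> r0 * ln y0"
    using y0 by (intro tendsto_intros lim) auto
  moreover have "(\<lambda>k. s k * (exp (r k * ln (y k)) - 1)) \<longlonglongrightarrow> s0 * (exp (r0 * ln y0) - 1)"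
    using y0 by (intro tendsto_intros lim) auto
  ultimately have "(\<lambda>k. dquot (\<lambda>z. exp z - 1) 1 (r k * ln (y k))) \<longlonglongrightarrow> dquot (\<lambda>z. exp z - 1) 1 (r0 * ln y0)"
    and "(\<lambda>k. dquot (\<lambda>z. ln (1 + z)) 1 (s k * (exp (r k * ln (y k)) - 1)))
      \<longlonglongrightarrow> dquot (\<lambda>z. ln (1 + z)) 1 (s0 * (exp (r0 * ln y0) - 1))"
    using isCont_tendsto_compose[OF E] isCont_tendsto_compose[OF L[OF pm_log_arg[OF s0]]] by blast+
  then show ?thesis
    unfolding pm_log_def using y0 by (intro tendsto_mult tendsto_ln lim) auto
qed

text \<open>Otherwise a subsequence stays away from \<open>L\<close>; by compactness it has a
  convergent further subsequence, whose limit must be \<open>L\<close>.\<close>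

lemma tendsto_of_unique_limit_point:
  fixes x :: "nat \<Rightarrow> 'b::metric_space"
  assumes K: "compact K" "\<And>k. x k \<in> K"
    and unique: "\<And>\<phi> l. strict_mono \<phi> \<Longrightarrow> (x \<circ> \<phi>) \<longlonglongrightarrow> l \<Longrightarrow> l \<in> K \<Longrightarrow> l = L"
  shows "x \<longlonglongrightarrow> L"
proof (rule ccontr)
  assume "\<not> x \<longlonglongrightarrow> L"
  then obtain \<epsilon> where \<epsilon>: "\<epsilon> > 0" "\<not> eventually (\<lambda>k. dist (x k) L < \<epsilon>) sequentially"
    unfolding tendsto_iff by blast
  then obtain \<phi> :: "nat \<Rightarrow> nat" where \<phi>: "strict_mono \<phi>" "\<And>n. \<not> dist (x (\<phi> n)) L < \<epsilon>"
    using not_eventually_sequentiallyD by blast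
  obtain l \<psi> where l: "l \<in> K" and \<psi>: "strict_mono \<psi>" "((x \<circ> \<phi>) \<circ> \<psi>) \<longlonglongrightarrow> l"
    using K unfolding compact_def by (metis comp_apply)
  have "l = L"
    using unique[of "\<phi> \<circ> \<psi>" l] l \<psi> \<phi>(1) by (simp add: strict_mono_o comp_assoc)
  then have "eventually (\<lambda>n. dist (x (\<phi> (\<psi> n))) L < \<epsilon>) sequentially"
    using \<psi>(2) \<epsilon>(1) by (auto simp: tendsto_iff)
  then show False
    using \<phi>(2) by (auto simp: eventually_sequentially)
qed

text \<open>Taking logarithms in the scalar equation for the deformed mean and dividing by \<open>s\<close> removes
  the degeneration at \<open>s = 0\<close>; \<open>M z\<close> is to be \<open>ln (f (exp z)) / z\<close> for the representing function
  \<open>f\<close> of \<open>\<tau>\<close>.\<close>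

definition fix_eq :: "(real \<Rightarrow> real) \<Rightarrow> real \<Rightarrow> real \<Rightarrow> real \<Rightarrow> real \<Rightarrow> real" where
  "fix_eq M t s r x = (let D = pm_log s r (t / x) - pm_log s r (1 / x)
     in pm_log s r (1 / x) + D * M (s * D))"

text \<open>The solutions stay in a compact interval of positive numbers and \<open>fix_eq\<close>
  is jointly continuous. Every limit point therefore solves the limiting equation, whose only
  positive solution is \<open>X s0 r0\<close>.\<close>

lemma tendsto_fix_eq_solution:
  fixes X :: "real \<Rightarrow> real \<Rightarrow> real"
  assumes M: "\<And>z. isCont M z" and t: "t > 0"
    and bounds: "\<And>s r. s \<in> {0..1} \<Longrightarrow> r \<in> R \<Longrightarrow> X s r \<in> {min 1 t..max 1 t}"
    and solution: "\<And>s r x. s \<in> {0..1} \<Longrightarrow> r \<in> R \<Longrightarrow> x > 0 \<Longrightarrow> fix_eq M t s r x = 0 \<longleftrightarrow> x = X s r"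
    and s: "\<And>k. s k \<in> {0..1}" "s0 \<in> {0..1}" "s \<longlonglongrightarrow> s0"
    and r: "\<And>k. r k \<in> R" "r0 \<in> R" "r \<longlonglongrightarrow> r0"
  shows "(\<lambda>k. X (s k) (r k)) \<longlonglongrightarrow> X s0 r0"
proof (rule tendsto_of_unique_limit_point)
  show "compact {min 1 t..max 1 t}"
    by simp
  show "X (s k) (r k) \<in> {min 1 t..max 1 t}" for k
    using bounds s r by blast
  fix \<phi> :: "nat \<Rightarrow> nat" and l
  assume \<phi>: "strict_mono \<phi>" and lim: "((\<lambda>k. X (s k) (r k)) \<circ> \<phi>) \<longlonglongrightarrow> l" and l: "l \<in> {min 1 t..max 1 t}"
  define x where "x k = X (s (\<phi> k)) (r (\<phi> k))" for k
  have lx: "x \<longlonglongrightarrow> l"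
    using lim by (simp add: x_def[abs_def] comp_def)
  have l0: "l > 0"
    using l t by auto
  have x0: "x k > 0" for k
    using bounds[OF s(1)[of "\<phi> k"] r(1)[of "\<phi> k"]] t by (auto simp: x_def)
  have ls: "(\<lambda>k. s (\<phi> k)) \<longlonglongrightarrow> s0" and lr: "(\<lambda>k. r (\<phi> k)) \<longlonglongrightarrow> r0"
    using LIMSEQ_subseq_LIMSEQ[OF s(3) \<phi>] LIMSEQ_subseq_LIMSEQ[OF r(3) \<phi>] by (simp_all add: comp_def)
  have p: "(\<lambda>k. pm_log (s (\<phi> k)) (r (\<phi> k)) (c / x k)) \<longlonglongrightarrow> pm_log s0 r0 (c / l)" if "c > 0" for c
    using that l0 s(2) by (intro tendsto_pm_log ls lr tendsto_divide lx tendsto_const) auto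
  have "(\<lambda>k. fix_eq M t (s (\<phi> k)) (r (\<phi> k)) (x k)) \<longlonglongrightarrow> fix_eq M t s0 r0 l"
    unfolding fix_eq_def Let_def
    by (intro tendsto_intros isCont_tendsto_compose[OF M] p ls t zero_less_one)
  moreover have "fix_eq M t (s (\<phi> k)) (r (\<phi> k)) (x k) = 0" for k
    using solution[OF s(1) r(1) x0] by (simp add: x_def)
  ultimately have "fix_eq M t s0 r0 l = 0"
    by (simp add: LIMSEQ_const_iff)
  then show "l = X s0 r0"
    using solution[OF s(2) r(2) l0] by simp
qed

text \<open>At \<open>s = 0\<close> the argument of \<open>M\<close> vanishes, so the equation is
  the average, with weights \<open>1 - \<alpha>\<close> and \<open>\<alpha>\<close>, of
  \<open>pm_log 0 r\<close> at \<open>1 / x\<close> and \<open>t / x\<close>. Multiplying by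
  \<open>x powr r\<close> when \<open>r\<close> is nonzero leaves
  \<open>x powr r = 1 - \<alpha> + \<alpha> * t powr r\<close>.\<close>

lemma fix_eq_zero_iff:
  assumes M: "M 0 = \<alpha>" and \<alpha>: "0 \<le> \<alpha>" "\<alpha> \<le> 1" and pos: "t > 0" "x > 0"
  shows "fix_eq M t 0 r x = 0 \<longleftrightarrow> x = power_mean_fun \<alpha> r t"
proof (cases "r = 0")
  case True
  have "fix_eq M t 0 r x = \<alpha> * ln t - ln x"
    using pos True by (simp add: fix_eq_def pm_log_0 M ln_div)
  also have "\<dots> = 0 \<longleftrightarrow> ln x = ln (t powr \<alpha>)"
    using pos by (auto simp: ln_powr)
  also have "\<dots> \<longleftrightarrow> x = t powr \<alpha>"
    using pos by (intro ln_inj_iff) auto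
  finally show ?thesis
    using True by (simp add: power_mean_fun_def)
next
  case False
  define c where "c = 1 - \<alpha> + \<alpha> * t powr r"
  have c0: "c > 0"
  proof (cases "\<alpha> = 0")
    case False
    then have "\<alpha> * t powr r > 0"
      using \<alpha> pos by simp
    then show ?thesis
      using \<alpha> by (simp add: c_def)
  qed (simp add: c_def)
  have xr: "x powr r > 0"
    using pos by simp
  have "fix_eq M t 0 r x = (c / x powr r - 1) / r"
    using pos False xr by (simp add: fix_eq_def pm_log_0 M c_def powr_divide field_simps)
  also have "\<dots> = 0 \<longleftrightarrow> x powr r = c"
    using False xr by (auto simp: field_simps)
  also have "\<dots> \<longleftrightarrow> x = c powr (1 / r)"
    using pos c0 False by (auto simp: powr_powr)
  finally show ?thesis
    using False by (simp add: power_mean_fun_def c_def)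
qed

text \<open>Multiplying by \<open>s\<close> turns the product with \<open>M\<close> into
  \<open>ln (f (exp z))\<close> at \<open>z = s * (b - a)\<close>; exponentiating recovers the
  multiplicative equation.\<close>

lemma fix_eq_pos_iff:
  assumes f: "\<And>y. y > 0 \<Longrightarrow> f y > 0" "f 1 = 1" and M: "M = dquot (\<lambda>z. ln (f (exp z))) \<alpha>"
    and s: "0 < s" "s \<le> 1" and pos: "t > 0" "x > 0"
  shows "fix_eq M t s r x = 0 \<longleftrightarrow>
    power_mean_fun s r (1 / x) * f (power_mean_fun s r (t / x) / power_mean_fun s r (1 / x)) = 1"
proof -
  define a b where "a = pm_log s r (1 / x)" and "b = pm_log s r (t / x)"
  have "s * (b - a) * M (s * (b - a)) = ln (f (exp (s * (b - a))))"
    unfolding M by (rule dquot_mult) (simp add: f)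
  then have "s * fix_eq M t s r x = s * a + ln (f (exp (s * (b - a))))"
    by (simp add: fix_eq_def Let_def a_def b_def distrib_left mult.assoc)
  then have "fix_eq M t s r x = 0 \<longleftrightarrow> s * a + ln (f (exp (s * (b - a)))) = 0"
    using s by (metis mult_eq_0_iff less_irrefl)
  also have "\<dots> \<longleftrightarrow> exp (s * a + ln (f (exp (s * (b - a))))) = 1"
    by simp
  also have "exp (s * a + ln (f (exp (s * (b - a))))) = exp (s * a) * f (exp (s * b) / exp (s * a))"
    by (simp add: exp_add f(1) right_diff_distrib exp_diff)
  finally show ?thesis
    using s pos by (simp add: power_mean_fun_eq_exp a_def b_def)
qed

text \<open>Restrict the operator equation to the operands 1 and \<open>t\<close> and the unknown
  \<open>x\<close>, all times the identity. Homogeneity extracts a factor \<open>x\<close> on the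
  right, which cancels.\<close>

lemma deformed_mean_scalar_iff:
  fixes \<tau> \<sigma> \<rho> :: "'a::complex_hilbert op_binary" and e :: 'a
  assumes e: "norm e = 1" and means: "operator_mean \<tau>" "operator_mean \<sigma>"
    and def: "is_deformed_mean \<tau> \<sigma> \<rho>" and pos: "t > 0" "x > 0"
  shows "rep_fun \<sigma> (1 / x) * rep_fun \<tau> (rep_fun \<sigma> (t / x) / rep_fun \<sigma> (1 / x)) = 1
    \<longleftrightarrow> x = rep_fun \<rho> t"
proof -
  let ?I = "id_blinfun :: 'a \<Rightarrow>\<^sub>L 'a"
  have inv: "positive_invertible_op (c *\<^sub>R ?I)" if "c > 0" for c
  proof -
    have "(c *\<^sub>R ?I) o\<^sub>L ((1 / c) *\<^sub>R ?I) = ?I" "((1 / c) *\<^sub>R ?I) o\<^sub>L (c *\<^sub>R ?I) = ?I"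
      using that by (auto intro!: blinfun_eqI simp: blinfun.scaleR_left blinfun.scaleR_right)
    then show ?thesis
      using positive_scalar_op[OF e, of c] that by (auto simp: positive_invertible_op_def)
  qed
  have \<rho>: "operator_mean \<rho>"
    using def by (simp add: is_deformed_mean_def)
  have s1: "rep_fun \<sigma> (1 / x) > 0" and s2: "rep_fun \<sigma> (t / x) > 0"
    using pos by (auto intro!: rep_fun_pos[OF means(2) e])
  have "\<sigma> (x *\<^sub>R ?I) (1 *\<^sub>R ?I) = (x * rep_fun \<sigma> (1 / x)) *\<^sub>R ?I"
    "\<sigma> (x *\<^sub>R ?I) (t *\<^sub>R ?I) = (x * rep_fun \<sigma> (t / x)) *\<^sub>R ?I"
    using pos by (intro mean_scalar_scalar[OF means(2) e]; simp)+
  then have \<tau>: "\<tau> (\<sigma> (x *\<^sub>R ?I) (1 *\<^sub>R ?I)) (\<sigma> (x *\<^sub>R ?I) (t *\<^sub>R ?I))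
      = (x * (rep_fun \<sigma> (1 / x) * rep_fun \<tau> (rep_fun \<sigma> (t / x) / rep_fun \<sigma> (1 / x)))) *\<^sub>R ?I"
    using pos s1 s2 mean_scalar_scalar[OF means(1) e, of "x * rep_fun \<sigma> (1 / x)" "x * rep_fun \<sigma> (t / x)"]
    by (simp add: mult.assoc)
  have "\<rho> (1 *\<^sub>R ?I) (t *\<^sub>R ?I) = rep_fun \<rho> t *\<^sub>R ?I"
    using mean_id_scalar[OF \<rho> e, of t] pos by simp
  moreover have "x *\<^sub>R ?I = \<tau> (\<sigma> (x *\<^sub>R ?I) (1 *\<^sub>R ?I)) (\<sigma> (x *\<^sub>R ?I) (t *\<^sub>R ?I))
      \<longleftrightarrow> x *\<^sub>R ?I = \<rho> (1 *\<^sub>R ?I) (t *\<^sub>R ?I)"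
    using def inv[of x] inv[of 1] inv[of t] pos unfolding is_deformed_mean_def by (meson zero_less_one)
  ultimately have "x = x * (rep_fun \<sigma> (1 / x) * rep_fun \<tau> (rep_fun \<sigma> (t / x) / rep_fun \<sigma> (1 / x)))
      \<longleftrightarrow> x = rep_fun \<rho> t"
    unfolding \<tau> by (simp only: scaleR_id_eq_iff[OF e])
  then show ?thesis
    using pos by auto
qed

section \<open>Joint continuity of the two-parameter family\<close>

theorem theorem3p9:
  fixes \<tau> :: "'a::complex_hilbert op_binary"
    and P T :: "real \<Rightarrow> real \<Rightarrow> 'a op_binary"
    and \<alpha> :: real
  assumes separable: "separable_space (euclidean :: 'a topology)"
    and infinite_dim: "\<And>B :: 'a set. finite B \<Longrightarrow> span B \<noteq> UNIV"
    and tau: "operator_mean \<tau>"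
    and alpha: "\<alpha> = deriv (rep_fun \<tau>) 1"
    and P: "\<And>s r. s \<in> {0..1} \<Longrightarrow> r \<in> {-1..1} \<Longrightarrow> is_power_mean s r (P s r)"
    and T: "\<And>s r. s \<in> {0<..1} \<Longrightarrow> r \<in> {-1..1} \<Longrightarrow> is_deformed_mean \<tau> (P s r) (T s r)"
  shows "rep_fun \<tau> field_differentiable (at 1) \<and> \<alpha> \<in> {0..1} \<and>
    (\<forall>s r r0. (\<forall>k. s k \<in> {0<..1}) \<and> (\<forall>k. r k \<in> {-1..1}) \<and>
        s \<longlonglongrightarrow> 0 \<and> r \<longlonglongrightarrow> r0 \<longrightarrow>
        converges_properly (\<lambda>k. T (s k) (r k)) (P \<alpha> r0)) \<and>
    (\<forall>s r s0 r0. (\<forall>k. s k \<in> {0..1}) \<and> (\<forall>k. r k \<in> {-1..1}) \<and>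
        s0 \<in> {0..1} \<and> r0 \<in> {-1..1} \<and> s \<longlonglongrightarrow> s0 \<and> r \<longlonglongrightarrow> r0 \<longrightarrow>
        converges_properly (\<lambda>k. extended_family P T \<alpha> (s k) (r k)) (extended_family P T \<alpha> s0 r0))"
proof -
  obtain e1 e2 :: 'a where orth: "norm e1 = 1" "norm e2 = 1" "cinner e1 e2 = 0"
    using exists_orthonormal_pair infinite_dim by metis
  note e = orth(1)
  obtain a where "(rep_fun \<tau> has_real_derivative a) (at 1)" "0 \<le> a" "a \<le> 1"
    using rep_fun_has_derivative_at_1[OF tau orth] by blast
  then have der: "(rep_fun \<tau> has_real_derivative \<alpha>) (at 1)" and \<alpha>: "0 \<le> \<alpha>" "\<alpha> \<le> 1"
    using alpha DERIV_imp_deriv by metis+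
  note f1 = rep_fun_1[OF tau e] and fpos = rep_fun_pos[OF tau e]
  define M where "M = dquot (\<lambda>z. ln (rep_fun \<tau> (exp z))) \<alpha>"
  have M: "isCont M z" for z
    unfolding M_def
  proof (rule isCont_dquot[where S = UNIV])
    \<comment> \<open>Since \<open>rep_fun \<tau> 1 = 1\<close>, the logarithmic derivative at 0 is
      \<alpha> itself, so the filled-in value \<open>M 0 = \<alpha>\<close> makes \<open>M\<close>
      continuous.\<close>
    have "((\<lambda>z. rep_fun \<tau> (exp z)) has_real_derivative \<alpha> * exp 0) (at 0)"
      using der by (intro DERIV_chain2[of "rep_fun \<tau>"]) (auto intro!: derivative_eq_intros)
    then show "((\<lambda>z. ln (rep_fun \<tau> (exp z))) has_real_derivative \<alpha>) (at 0)"
      by (auto intro!: derivative_eq_intros simp: f1)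
    have "continuous_on UNIV (\<lambda>z. rep_fun \<tau> (exp z))"
      by (rule continuous_on_compose2[OF continuous_on_rep_fun[OF tau orth]]) (auto intro!: continuous_intros)
    then show "continuous_on UNIV (\<lambda>z. ln (rep_fun \<tau> (exp z)))"
      using fpos by (intro continuous_on_ln) (auto simp: less_imp_neq[symmetric])
  qed (auto simp: f1)
  \<comment> \<open>Every member being an operator mean, \<open>rep_fun_bounds\<close> places all
    values at \<open>t\<close> between \<open>min 1 t\<close> and \<open>max 1 t\<close>.\<close>
  have mean: "operator_mean (extended_family P T \<alpha> s r)" if "s \<in> {0..1}" "r \<in> {-1..1}" for s r
    using that P[of \<alpha> r] T[of s r] \<alpha>
    by (auto simp: extended_family_def is_power_mean_def is_deformed_mean_def)
  \<comment> \<open>A single equation characterizes the whole family: at \<open>s = 0\<close> it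
    singles out the power mean with weight \<alpha>, and for \<open>s > 0\<close> it is the scalar
    equation of the deformed mean.\<close>
  have solution: "fix_eq M t s r x = 0 \<longleftrightarrow> x = rep_fun (extended_family P T \<alpha> s r) t"
    if "t > 0" "s \<in> {0..1}" "r \<in> {-1..1}" "x > 0" for t s r x
  proof (cases "s = 0")
    case True
    have "rep_fun (P \<alpha> r) t = power_mean_fun \<alpha> r t"
      using P[of \<alpha> r] \<alpha> that by (simp add: is_power_mean_def)
    then show ?thesis
      using True fix_eq_zero_iff[of M \<alpha> t x r] \<alpha> that by (simp add: extended_family_def M_def dquot_def)
  next
    case False
    with that have s: "0 < s" "s \<le> 1"
      by auto
    have P': "operator_mean (P s r)" "\<And>y. y > 0 \<Longrightarrow> rep_fun (P s r) y = power_mean_fun s r y"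
      using P[of s r] that by (auto simp: is_power_mean_def)
    have "is_deformed_mean \<tau> (P s r) (T s r)"
      using T s that by simp
    from deformed_mean_scalar_iff[OF e tau P'(1) this, of t x] fix_eq_pos_iff[OF fpos f1 M_def s, of t x r]
    show ?thesis
      using that False by (simp add: P'(2) extended_family_def)
  qed
  have conv: "converges_properly (\<lambda>k. extended_family P T \<alpha> (s k) (r k)) (extended_family P T \<alpha> s0 r0)"
    if "\<And>k. s k \<in> {0..1}" "\<And>k. r k \<in> {-1..1}" "s0 \<in> {0..1}" "r0 \<in> {-1..1}" "s \<longlonglongrightarrow> s0" "r \<longlonglongrightarrow> r0"
    for s r s0 r0
    unfolding converges_properly_def
  proof (intro allI impI)
    fix t :: real
    assume t: "t > 0"
    show "(\<lambda>k. rep_fun (extended_family P T \<alpha> (s k) (r k)) t) \<longlonglongrightarrow> rep_fun (extended_family P T \<alpha> s0 r0) t"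
      by (rule tendsto_fix_eq_solution[OF M t _ solution[OF t], where R = "{-1..1}"])
        (use that rep_fun_bounds[OF mean e t] in auto)
  qed
  have conv0: "converges_properly (\<lambda>k. T (s k) (r k)) (P \<alpha> r0)"
    if s: "\<And>k. s k \<in> {0<..1}" and r: "\<And>k. r k \<in> {-1..1}" and lim: "s \<longlonglongrightarrow> 0" "r \<longlonglongrightarrow> r0" for s r r0
  proof -
    \<comment> \<open>Here the range of the limit \<open>r0\<close> is not assumed; it follows from
      closedness of the interval.\<close>
    have "r0 \<in> {-1..1}"
      using closed_sequentially[of "{-1..1::real}" r r0] r lim by auto
    moreover have "s k \<in> {0..1}" for k
      using s[of k] by auto
    ultimately have "converges_properly (\<lambda>k. extended_family P T \<alpha> (s k) (r k)) (extended_family P T \<alpha> 0 r0)"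
      using r lim by (intro conv) auto
    moreover have "s k \<noteq> 0" for k
      using s[of k] by auto
    ultimately show ?thesis
      by (simp add: extended_family_def)
  qed
  have "rep_fun \<tau> field_differentiable (at 1)"
    using der by (auto simp: field_differentiable_def)
  moreover have "\<alpha> \<in> {0..1}"
    using \<alpha> by simp
  ultimately show ?thesis
    using conv conv0 by blast
qed

end
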